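(* Let $f_1,\dots,f_s$ be nonzero elements of $\mathbf F=\mathbb K[\![x_1,\dots,x_n]\!]$, $\mathbf A=\mathbb K[\![f_1,\dots,f_s]\!]$, and let $a\in U_1^n$, with $f_1,\dots,f_s$ monic with respect to $a$. Let $\{\bar S_1,\dots,\bar S_m\}$ be the set of $S$-polynomials associated with $\{f_1,\dots,f_s\}$, and for all $i\in\{1,\dots,m\}$ set $S_i=\bar S_i(f_1,\dots,f_s)$. The following conditions are equivalent: (1) the set $\{f_1,\dots,f_s\}$ is an $a$-canonical basis of $\mathbf A$; (2) for all $i\in\{1,\dots,m\}$, $R_a(S_i,\{f_1,\dots,f_s\})=0$.
   Context: $\mathbb K$ is a field, $n\ge 1$, $\underline x=(x_1,\dots,x_n)$, $\mathbf F=\mathbb K[\![x_1,\dots,x_n]\!]$, $U_1=\mathbb Q_{>0}$. Fix a total well ordering $\prec$ on $\mathbb N^n$ compatible with sums. For $a\in U_1^n$ and a nonzero $f=\sum c_\alpha\underline x^\alpha\in\mathbf F$: $\mathrm{Supp}(f)=\{\alpha\mid c_\alpha\ne0\}$; $\nu(f,a)=\min\{a\cdot\alpha\mid\alpha\in\mathrm{Supp}(f)\}$; $\mathrm{in}(f,a)=\sum_{\alpha\in\mathrm{Supp}(f),\,a\cdot\alpha=\nu(f,a)}c_\alpha\underline x^\alpha$; $\mathrm{exp}(f,a)=\max_\prec\mathrm{Supp}(\mathrm{in}(f,a))$; $\mathrm M(f,a)=c_{\mathrm{exp}(f,a)}\underline x^{\mathrm{exp}(f,a)}$; $f$ is monic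 (with respect to $a$) if $c_{\mathrm{exp}(f,a)}=1$. The total ordering $<_a$ on $\mathbb N^n$ is: $\alpha<_a\alpha'$ iff $a\cdot\alpha>a\cdot\alpha'$, or $a\cdot\alpha=a\cdot\alpha'$ and $\alpha\prec\alpha'$; thus $\mathrm{exp}(f,a)=\max_{<_a}\mathrm{Supp}(f)$. For $S\subseteq\mathbf F$, $\mathbb K[\![S]\!]$ is the closure, in the $(x_1,\dots,x_n)$-adic topology, of the $\mathbb K$-subalgebra generated by $S$ (for a finite set of series without constant term it is the set of all formal power series in them). $\mathrm{exp}(\mathbf A,a)=\{\mathrm{exp}(f,a)\mid f\in\mathbf A\setminus\{0\}\}$, a subsemigroup of $\mathbb N^n$ containing $0$. A finite set $\{g_1,\dots,g_r\}\subseteq\mathbf A$ is an $a$-canonical basis of $\mathbf A$ if $\mathrm{exp}(\mathbf A,a)$ is generated by $\mathrm{exp}(g_1,a),\dots,\mathrm{exp}(g_r,a)$. $a$-remainder: for nonzero $F_1,\dots,F_q\in\mathbf F$ and $0\ne F\in\mathbf F$, an $a$-remainder $R=R_a(F,\{F_1,\dots,F_q\})$ is an element $R\in\mathbf F$ for which there is $H\in\mathbb K[\![F_1,\dots,F_q]\!]$ such that: (1) $F=H+R$, and $\mathrm{exp}(F,a)=\max_{<_a}(\mathrm{exp}(H,a),\mathrm{exp}(R,a))$ if $H\neq0\neq R$; (2) $H$ has an expression $H=\sum_\alpha c_\alpha\prod_{i}F_i^{\alpha_i}$ (convergent sum) with $\mathrm{exp}(F,a)\ge_a\mathrm{exp}(\prod_iF_i^{\alpha_i},a)$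 whenever $c_\alpha\ne0$, and if $R=0$ there is a unique $\alpha^0$ with $c_{\alpha^0}\neq0$ and $\mathrm{exp}(F,a)=\mathrm{exp}(\prod_iF_i^{\alpha^0_i},a)$; (3) if $R\ne0$, then every $\beta\in\mathrm{Supp}(R)$ satisfies $\beta\notin\langle\mathrm{exp}(F_1,a),\dots,\mathrm{exp}(F_q,a)\rangle$ and $\beta\le_a\mathrm{exp}(F,a)$. Remainders always exist but need not be unique in general; $R_a(F,\cdot)$ denotes a remainder so obtained, and $R_a(0,\cdot)=0$. $S$-polynomials: let $\phi:\mathbb K[X_1,\dots,X_s]\to\mathbb K[\mathrm M(f_1,a),\dots,\mathrm M(f_s,a)]$ be the $\mathbb K$-algebra morphism with $\phi(X_i)=\mathrm M(f_i,a)$. Its kernel is generated by binomials. Fix a well ordering $\prec_g$ on $\mathbb N^s$ compatible with sums (a monomial order). The $S$-polynomials associated with $\{f_1,\dots,f_s\}$ are the elements $\bar S_1,\dots,\bar S_m$ of the minimal reduced Gröbner basis of $\mathrm{Ker}(\phi)$ with respect to $\prec_g$ (each is a binomial). *)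

theory Defs
  imports "HOL-Analysis.Analysis" "HOL-Library.Poly_Mapping"
begin

section \<open>Formal power series in finitely many variables\<close>

text \<open>
  The variables are indexed by a finite type \<open>'n\<close>, and exponents are elements of
  \<open>nat ^ 'n\<close>, whose library order \<open>\<le>\<close> is componentwise (divisibility of monomials).
\<close>

typedef (overloaded) ('k, 'n) mfps = "UNIV :: (nat ^ 'n::finite \<Rightarrow> 'k) set"
  morphisms mfps_nth Abs_mfps
  by simp

setup_lifting type_definition_mfps

lemma mfps_eqI: "(\<And>\<alpha>. mfps_nth f \<alpha> = mfps_nth g \<alpha>) \<Longrightarrow> f = g"
  by (metis ext mfps_nth_inject)

lemma finite_exponents_le: "finite {\<alpha> :: nat ^ 'n::finite. \<alpha> \<le> \<gamma>}"
proof -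
  have "{\<alpha>. \<alpha> \<le> \<gamma>} \<subseteq> vec_lambda ` (Pi\<^sub>E UNIV (\<lambda>i. {..\<gamma> $ i}))"
  proof
    fix \<alpha> :: "nat ^ 'n" assume "\<alpha> \<in> {\<alpha>. \<alpha> \<le> \<gamma>}"
    then have "vec_nth \<alpha> \<in> Pi\<^sub>E UNIV (\<lambda>i. {..\<gamma> $ i})"
      by (auto simp: less_eq_vec_def)
    then show "\<alpha> \<in> vec_lambda ` (Pi\<^sub>E UNIV (\<lambda>i. {..\<gamma> $ i}))"
      by (metis image_eqI vec_nth_inverse)
  qed
  then show ?thesis
    by (rule finite_subset) (intro finite_imageI finite_PiE, auto)
qed

lemma finite_exponent_pairs: "finite {(\<alpha>, \<beta>). \<alpha> + \<beta> = (\<gamma> :: nat ^ 'n::finite)}"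
proof (rule finite_subset)
  show "{(\<alpha>, \<beta>). \<alpha> + \<beta> = \<gamma>} \<subseteq> {\<alpha>. \<alpha> \<le> \<gamma>} \<times> {\<beta>. \<beta> \<le> \<gamma>}"
    by (auto simp: less_eq_vec_def)
  show "finite ({\<alpha>. \<alpha> \<le> \<gamma>} \<times> {\<beta>. \<beta> \<le> \<gamma>})"
    by (intro finite_cartesian_product finite_exponents_le)
qed

instantiation mfps :: (comm_ring_1, finite) comm_ring_1
begin

lift_definition zero_mfps :: "('a, 'b) mfps" is "\<lambda>_. 0" .
lift_definition one_mfps :: "('a, 'b) mfps" is "\<lambda>\<gamma>. if \<gamma> = 0 then 1 else 0" .
lift_definition plus_mfps :: "('a, 'b) mfps \<Rightarrow> ('a, 'b) mfps \<Rightarrow> ('a, 'b) mfps"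
  is "\<lambda>f g \<gamma>. f \<gamma> + g \<gamma>" .
lift_definition minus_mfps :: "('a, 'b) mfps \<Rightarrow> ('a, 'b) mfps \<Rightarrow> ('a, 'b) mfps"
  is "\<lambda>f g \<gamma>. f \<gamma> - g \<gamma>" .
lift_definition uminus_mfps :: "('a, 'b) mfps \<Rightarrow> ('a, 'b) mfps"
  is "\<lambda>f \<gamma>. - f \<gamma>" .
lift_definition times_mfps :: "('a, 'b) mfps \<Rightarrow> ('a, 'b) mfps \<Rightarrow> ('a, 'b) mfps"
  is "\<lambda>f g \<gamma>. \<Sum>(\<alpha>, \<beta>) \<in> {(\<alpha>, \<beta>). \<alpha> + \<beta> = \<gamma>}. f \<alpha> * g \<beta>" .

instance
proof
  fix f g h :: "('a, 'b) mfps"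
  show "f + g + h = f + (g + h)" by transfer (simp add: add.assoc)
  show "f + g = g + f" by transfer (simp add: add.commute)
  show "0 + f = f" by transfer simp
  show "- f + f = 0" by transfer simp
  show "f - g = f + - g" by transfer simp
  show "(0 :: ('a, 'b) mfps) \<noteq> 1" by transfer (metis zero_neq_one)
  show "f * g = g * f"
  proof (transfer, rule ext)
    fix f g :: "nat ^ 'b \<Rightarrow> 'a" and \<gamma> :: "nat ^ 'b"
    show "(\<Sum>(\<alpha>, \<beta>) \<in> {(\<alpha>, \<beta>). \<alpha> + \<beta> = \<gamma>}. f \<alpha> * g \<beta>) =
          (\<Sum>(\<alpha>, \<beta>) \<in> {(\<alpha>, \<beta>). \<alpha> + \<beta> = \<gamma>}. g \<alpha> * f \<beta>)"
      by (rule sum.reindex_bij_witness[where i = prod.swap and j = prod.swap])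
        (auto simp: add.commute mult.commute)
  qed
  show "1 * f = f"
  proof (transfer, rule ext)
    fix f :: "nat ^ 'b \<Rightarrow> 'a" and \<gamma> :: "nat ^ 'b"
    let ?t = "\<lambda>(\<alpha> :: nat ^ 'b, \<beta>). (if \<alpha> = 0 then 1 else 0) * f \<beta>"
    have "sum ?t {(\<alpha>, \<beta>). \<alpha> + \<beta> = \<gamma>} = sum ?t {(0, \<gamma>)}"
      by (rule sum.mono_neutral_right) (auto simp: finite_exponent_pairs split: if_splits)
    then show "(\<Sum>(\<alpha>, \<beta>) \<in> {(\<alpha>, \<beta>). \<alpha> + \<beta> = \<gamma>}. (if \<alpha> = 0 then 1 else 0) * f \<beta>) = f \<gamma>"
      by simp
  qed
  show "(f + g) * h = f * h + g * h"
    by (transfer, rule ext) (simp add: distrib_right sum.distrib split_def)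
  show "f * g * h = f * (g * h)"
  proof (transfer, rule ext)
    fix f g h :: "nat ^ 'b \<Rightarrow> 'a" and \<gamma> :: "nat ^ 'b"
    let ?P = "\<lambda>\<gamma> :: nat ^ 'b. {(\<alpha>, \<beta>). \<alpha> + \<beta> = \<gamma>}"
    have "(\<Sum>(\<alpha>, \<beta>) \<in> ?P \<gamma>. (\<Sum>(\<alpha>, \<beta>) \<in> ?P \<alpha>. f \<alpha> * g \<beta>) * h \<beta>) =
          (\<Sum>x \<in> ?P \<gamma>. \<Sum>y \<in> ?P (fst x). f (fst y) * g (snd y) * h (snd x))"
      by (simp add: split_def sum_distrib_right)
    also have "\<dots> = (\<Sum>(x, y) \<in> (SIGMA x:?P \<gamma>. ?P (fst x)). f (fst y) * g (snd y) * h (snd x))"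
      by (rule sum.Sigma) (auto simp: finite_exponent_pairs)
    also have "\<dots> = (\<Sum>(x, y) \<in> (SIGMA x:?P \<gamma>. ?P (snd x)). f (fst x) * (g (fst y) * h (snd y)))"
      by (rule sum.reindex_bij_witness[where
            i = "\<lambda>(x, y). ((fst x + fst y, snd y), (fst x, fst y))" and
            j = "\<lambda>(x, y). ((fst y, snd y + snd x), (snd y, snd x))"])
        (auto simp: add.assoc mult.assoc)
    also have "\<dots> = (\<Sum>x \<in> ?P \<gamma>. \<Sum>y \<in> ?P (snd x). f (fst x) * (g (fst y) * h (snd y)))"
      by (rule sum.Sigma[symmetric]) (auto simp: finite_exponent_pairs)
    also have "\<dots> = (\<Sum>(\<alpha>, \<beta>) \<in> ?P \<gamma>. f \<alpha> * (\<Sum>(\<alpha>, \<beta>) \<in> ?P \<beta>. g \<alpha> * h \<beta>))"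
      by (simp add: split_def sum_distrib_left)
    finally show "(\<Sum>(\<alpha>, \<beta>) \<in> ?P \<gamma>. (\<Sum>(\<alpha>, \<beta>) \<in> ?P \<alpha>. f \<alpha> * g \<beta>) * h \<beta>) =
          (\<Sum>(\<alpha>, \<beta>) \<in> ?P \<gamma>. f \<alpha> * (\<Sum>(\<alpha>, \<beta>) \<in> ?P \<beta>. g \<alpha> * h \<beta>))" .
  qed
qed

end

lift_definition mfps_monom :: "'k::zero \<Rightarrow> nat ^ 'n::finite \<Rightarrow> ('k, 'n) mfps"
  is "\<lambda>c \<alpha> \<beta>. if \<beta> = \<alpha> then c else 0" .

abbreviation mfps_const :: "'k::zero \<Rightarrow> ('k, 'n::finite) mfps"
  where "mfps_const c \<equiv> mfps_monom c 0"

definition total_degree :: "nat ^ 'n::finite \<Rightarrow> nat"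
  where "total_degree \<alpha> = (\<Sum>i\<in>UNIV. \<alpha> $ i)"

text \<open>
  The adic topology of the ideal \<open>\<mm>\<close> generated by the variables: the sets
  \<open>f + \<mm>\<^sup>d\<close> are basic neighbourhoods of \<open>f\<close>, and \<open>\<mm>\<^sup>d\<close> consists of the series
  all of whose coefficients in total degree less than \<open>d\<close> vanish.
\<close>

instantiation mfps :: (type, finite) topological_space
begin

definition open_mfps :: "('a, 'b) mfps set \<Rightarrow> bool" where
  "open_mfps U \<longleftrightarrow>
    (\<forall>f\<in>U. \<exists>d. \<forall>g. (\<forall>\<alpha>. total_degree \<alpha> < d \<longrightarrow> mfps_nth g \<alpha> = mfps_nth f \<alpha>) \<longrightarrow> g \<in> U)"

instance
proof
  show "open (UNIV :: ('a, 'b) mfps set)" by (simp add: open_mfps_def)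
next
  fix S T :: "('a, 'b) mfps set"
  assume S: "open S" and T: "open T"
  show "open (S \<inter> T)" unfolding open_mfps_def
  proof
    fix f assume f: "f \<in> S \<inter> T"
    obtain d where d: "\<And>g. (\<forall>\<alpha>. total_degree \<alpha> < d \<longrightarrow> mfps_nth g \<alpha> = mfps_nth f \<alpha>) \<Longrightarrow> g \<in> S"
      using S f unfolding open_mfps_def by blast
    obtain e where e: "\<And>g. (\<forall>\<alpha>. total_degree \<alpha> < e \<longrightarrow> mfps_nth g \<alpha> = mfps_nth f \<alpha>) \<Longrightarrow> g \<in> T"
      using T f unfolding open_mfps_def by blast
    show "\<exists>d. \<forall>g. (\<forall>\<alpha>. total_degree \<alpha> < d \<longrightarrow> mfps_nth g \<alpha> = mfps_nth f \<alpha>) \<longrightarrow> g \<in> S \<inter> T"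
      by (rule exI[of _ "max d e"]) (auto intro: d e)
  qed
next
  fix \<K> :: "('a, 'b) mfps set set"
  assume "\<forall>S\<in>\<K>. open S"
  then show "open (\<Union>\<K>)" unfolding open_mfps_def by (meson UnionE UnionI)
qed

end

instance mfps :: (type, finite) t2_space
proof
  fix f g :: "('a, 'b) mfps"
  assume "f \<noteq> g"
  then obtain \<alpha> where \<alpha>: "mfps_nth f \<alpha> \<noteq> mfps_nth g \<alpha>" using mfps_eqI by blast
  have op: "open {h :: ('a, 'b) mfps. mfps_nth h \<alpha> = c}" for c
    unfolding open_mfps_def by (auto intro!: exI[of _ "Suc (total_degree \<alpha>)"])
  show "\<exists>U V. open U \<and> open V \<and> f \<in> U \<and> g \<in> V \<and> U \<inter> V = {}"
    using \<alpha> by (intro exI conjI) (rule op[of "mfps_nth f \<alpha>"], rule op[of "mfps_nth g \<alpha>"], auto)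
qed


section \<open>Orderings and leading exponents\<close>

text \<open>
  Orderings are given by their reflexive relations: \<open>(\<alpha>, \<beta>) \<in> r\<close> means
  \<open>\<alpha> \<preceq> \<beta>\<close>.
\<close>

definition compatible_well_order :: "(nat ^ 'n::finite) rel \<Rightarrow> bool" where
  "compatible_well_order r \<longleftrightarrow>
    well_order_on UNIV r \<and> (\<forall>\<alpha> \<beta> \<gamma>. (\<alpha>, \<beta>) \<in> r \<longrightarrow> (\<alpha> + \<gamma>, \<beta> + \<gamma>) \<in> r)"

definition max_wrt :: "'a rel \<Rightarrow> 'a set \<Rightarrow> 'a" where
  "max_wrt r S = (THE m. m \<in> S \<and> (\<forall>x\<in>S. (x, m) \<in> r))"

definition weight :: "rat ^ 'n::finite \<Rightarrow> nat ^ 'n \<Rightarrow> rat" where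
  "weight a \<alpha> = (\<Sum>i\<in>UNIV. a $ i * of_nat (\<alpha> $ i))"

text \<open>The reflexive form \<open>\<le>\<^sub>a\<close>; note that a smaller weight makes an exponent larger.\<close>

definition weight_order :: "(nat ^ 'n::finite) rel \<Rightarrow> rat ^ 'n \<Rightarrow> (nat ^ 'n) rel" where
  "weight_order r a =
    {(\<alpha>, \<beta>). weight a \<alpha> > weight a \<beta> \<or> weight a \<alpha> = weight a \<beta> \<and> (\<alpha>, \<beta>) \<in> r}"

definition mfps_supp :: "('k::zero, 'n::finite) mfps \<Rightarrow> (nat ^ 'n) set" where
  "mfps_supp f = {\<alpha>. mfps_nth f \<alpha> \<noteq> 0}"

definition initial_weight :: "rat ^ 'n::finite \<Rightarrow> ('k::zero, 'n) mfps \<Rightarrow> rat" where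
  "initial_weight a f = (LEAST v. v \<in> weight a ` mfps_supp f)"

definition initial_form :: "rat ^ 'n::finite \<Rightarrow> ('k::zero, 'n) mfps \<Rightarrow> ('k, 'n) mfps" where
  "initial_form a f =
    Abs_mfps (\<lambda>\<alpha>. if weight a \<alpha> = initial_weight a f then mfps_nth f \<alpha> else 0)"

definition lead_exp :: "(nat ^ 'n::finite) rel \<Rightarrow> rat ^ 'n \<Rightarrow> ('k::zero, 'n) mfps \<Rightarrow> nat ^ 'n" where
  "lead_exp r a f = max_wrt r (mfps_supp (initial_form a f))"

definition lead_monomial ::
    "(nat ^ 'n::finite) rel \<Rightarrow> rat ^ 'n \<Rightarrow> ('k::zero, 'n) mfps \<Rightarrow> ('k, 'n) mfps" where
  "lead_monomial r a f = mfps_monom (mfps_nth f (lead_exp r a f)) (lead_exp r a f)"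

definition monic_wrt :: "(nat ^ 'n::finite) rel \<Rightarrow> rat ^ 'n \<Rightarrow> ('k::zero_neq_one, 'n) mfps \<Rightarrow> bool" where
  "monic_wrt r a f \<longleftrightarrow> mfps_nth f (lead_exp r a f) = 1"


section \<open>Complete subalgebras and canonical bases\<close>

definition mfps_subalgebra :: "('k::comm_ring_1, 'n::finite) mfps set \<Rightarrow> bool" where
  "mfps_subalgebra B \<longleftrightarrow>
    range mfps_const \<subseteq> B \<and> (\<forall>f\<in>B. \<forall>g\<in>B. f + g \<in> B \<and> f * g \<in> B)"

definition complete_algebra :: "('k::comm_ring_1, 'n::finite) mfps set \<Rightarrow> ('k, 'n) mfps set" where
  "complete_algebra S = closure (mfps_subalgebra hull S)"

definition add_submonoid :: "'a::comm_monoid_add set \<Rightarrow> bool" where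
  "add_submonoid M \<longleftrightarrow> 0 \<in> M \<and> (\<forall>x\<in>M. \<forall>y\<in>M. x + y \<in> M)"

definition lead_exps ::
    "(nat ^ 'n::finite) rel \<Rightarrow> rat ^ 'n \<Rightarrow> ('k::comm_ring_1, 'n) mfps set \<Rightarrow> (nat ^ 'n) set" where
  "lead_exps r a B = lead_exp r a ` (B - {0})"

definition canonical_basis ::
    "(nat ^ 'n::finite) rel \<Rightarrow> rat ^ 'n \<Rightarrow> ('k::comm_ring_1, 'n) mfps set \<Rightarrow> ('k, 'n) mfps set \<Rightarrow> bool" where
  "canonical_basis r a A G \<longleftrightarrow>
    finite G \<and> G \<subseteq> A \<and> 0 \<notin> G \<and> lead_exps r a A = add_submonoid hull (lead_exp r a ` G)"


section \<open>Remainders\<close>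

definition mfps_power_prod :: "('s::finite \<Rightarrow> ('k::comm_ring_1, 'n::finite) mfps) \<Rightarrow> nat ^ 's \<Rightarrow> ('k, 'n) mfps" where
  "mfps_power_prod F \<alpha> = (\<Prod>i\<in>UNIV. F i ^ (\<alpha> $ i))"

text \<open>
  \<open>is_remainder r a F P R\<close>: the series \<open>R\<close> is one of the (in general several)
  remainders of \<open>P\<close> with respect to the family \<open>F\<close>.
\<close>

definition is_remainder ::
    "(nat ^ 'n::finite) rel \<Rightarrow> rat ^ 'n \<Rightarrow> ('s::finite \<Rightarrow> ('k::comm_ring_1, 'n) mfps) \<Rightarrow>
     ('k, 'n) mfps \<Rightarrow> ('k, 'n) mfps \<Rightarrow> bool" where
  "is_remainder r a F P R \<longleftrightarrow>
    (if P = 0 then R = 0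
     else \<exists>H \<in> complete_algebra (range F).
       P = H + R \<and>
       (H \<noteq> 0 \<and> R \<noteq> 0 \<longrightarrow>
          lead_exp r a P = max_wrt (weight_order r a) {lead_exp r a H, lead_exp r a R}) \<and>
       (\<exists>c. ((\<lambda>\<alpha>. mfps_const (c \<alpha>) * mfps_power_prod F \<alpha>) has_sum H) UNIV \<and>
          (\<forall>\<alpha>. c \<alpha> \<noteq> 0 \<longrightarrow>
             (lead_exp r a (mfps_power_prod F \<alpha>), lead_exp r a P) \<in> weight_order r a) \<and>
          (R = 0 \<longrightarrow>
             (\<exists>!\<alpha>. c \<alpha> \<noteq> 0 \<and> lead_exp r a P = lead_exp r a (mfps_power_prod F \<alpha>)))) \<and>
       (R \<noteq> 0 \<longrightarrow>
          (\<forall>\<beta> \<in> mfps_supp R.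
             \<beta> \<notin> add_submonoid hull (range (\<lambda>i. lead_exp r a (F i))) \<and>
             (\<beta>, lead_exp r a P) \<in> weight_order r a)))"


section \<open>Polynomials, Groebner bases and S-polynomials\<close>

text \<open>
  The polynomial ring in variables indexed by \<open>'s\<close> is \<open>(nat ^ 's) \<Rightarrow>\<^sub>0 'k\<close>.
\<close>

definition mfps_subst ::
    "('s::finite \<Rightarrow> ('k::comm_ring_1, 'n::finite) mfps) \<Rightarrow> ((nat ^ 's) \<Rightarrow>\<^sub>0 'k) \<Rightarrow> ('k, 'n) mfps" where
  "mfps_subst F p = (\<Sum>\<alpha>\<in>Poly_Mapping.keys p. mfps_const (Poly_Mapping.lookup p \<alpha>) * mfps_power_prod F \<alpha>)"

text \<open>
  The kernel of the morphism sending the \<open>i\<close>-th variable to the leading monomial of \<open>F i\<close>;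
  its codomain is regarded as a subring of the power series ring.
\<close>

definition lead_monomial_kernel ::
    "(nat ^ 'n::finite) rel \<Rightarrow> rat ^ 'n \<Rightarrow> ('s::finite \<Rightarrow> ('k::comm_ring_1, 'n) mfps) \<Rightarrow>
     ((nat ^ 's) \<Rightarrow>\<^sub>0 'k) set" where
  "lead_monomial_kernel r a F = {p. mfps_subst (\<lambda>i. lead_monomial r a (F i)) p = 0}"

definition poly_lead_exp :: "(nat ^ 's::finite) rel \<Rightarrow> ((nat ^ 's) \<Rightarrow>\<^sub>0 'k::zero) \<Rightarrow> nat ^ 's" where
  "poly_lead_exp q p = max_wrt q (Poly_Mapping.keys p)"

definition groebner_basis ::
    "(nat ^ 's::finite) rel \<Rightarrow> ((nat ^ 's) \<Rightarrow>\<^sub>0 'k::zero) set \<Rightarrow> ((nat ^ 's) \<Rightarrow>\<^sub>0 'k) set \<Rightarrow> bool" where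
  "groebner_basis q I G \<longleftrightarrow>
    finite G \<and> G \<subseteq> I \<and> 0 \<notin> G \<and>
    (\<forall>p\<in>I. p \<noteq> 0 \<longrightarrow> (\<exists>g\<in>G. poly_lead_exp q g \<le> poly_lead_exp q p))"

text \<open>
  The last condition says that no monomial of an element of \<open>G\<close> is divisible by the leading
  monomial of another element; in particular \<open>G\<close> is minimal.
\<close>

definition reduced_groebner_basis ::
    "(nat ^ 's::finite) rel \<Rightarrow> ((nat ^ 's) \<Rightarrow>\<^sub>0 'k::zero_neq_one) set \<Rightarrow> ((nat ^ 's) \<Rightarrow>\<^sub>0 'k) set \<Rightarrow> bool" where
  "reduced_groebner_basis q I G \<longleftrightarrow>
    groebner_basis q I G \<and>
    (\<forall>g\<in>G. Poly_Mapping.lookup g (poly_lead_exp q g) = 1) \<and>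
    (\<forall>g\<in>G. \<forall>h\<in>G - {g}. \<forall>\<alpha>\<in>Poly_Mapping.keys g. \<not> poly_lead_exp q h \<le> \<alpha>)"

text \<open>
  \<open>s_polynomials r a q F G\<close>: \<open>G\<close> is the set of S-polynomials associated with the
  family \<open>F\<close>, with respect to the monomial order \<open>q\<close>.
\<close>

definition s_polynomials ::
    "(nat ^ 'n::finite) rel \<Rightarrow> rat ^ 'n \<Rightarrow> (nat ^ 's::finite) rel \<Rightarrow>
     ('s \<Rightarrow> ('k::comm_ring_1, 'n) mfps) \<Rightarrow> ((nat ^ 's) \<Rightarrow>\<^sub>0 'k) set \<Rightarrow> bool" where
  "s_polynomials r a q F G \<longleftrightarrow> reduced_groebner_basis q (lead_monomial_kernel r a F) G"

end

theory Submission
  imports Defs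
begin

text \<open>
  The products of powers \<open>f\<^sup>\<alpha>\<close> are monic, and their leading exponents \<open>prod_exp \<alpha>\<close> are the elements of
  the semigroup \<open>lead_monoid\<close> generated by the leading exponents of the family.  The family is a
  canonical basis iff no element of the algebra leads outside this semigroup.  Positivity of the weights
  makes the set of exponents above any given one finite; this is why infinite reductions converge
  and why descents stop.

  Every series has a remainder (\<open>exists_remainder\<close>): expand it along monic series, one for each exponent,
  taking a product of powers wherever the semigroup permits and a bare monomial elsewhere.  For a
  canonical basis, a remainder of an element of the algebra is again in the algebra, but has no
  exponent in the semigroup, so it vanishes (\<open>remainder_eq_zero\<close>).  Existence and vanishing
  together also show that \<open>0\<close> is a remainder, which reconciles the two readings of the second
  condition.

  Conversely (\<open>canonical_basis_of_zero_remainders\<close>), the leading exponent of an element \<open>h\<close> of the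
  algebra is visible on a polynomial in the family that approximates \<open>h\<close>.  If the terms of
  this polynomial reach above the leading exponent of \<open>h\<close>, their leading monomials cancel, hence
  form a homogeneous relation.  The reduced Groebner basis of the relations consists
  of homogeneous elements, so division expresses this relation through monomial multiples of
  S-polynomials in the same degree; as the substituted S-polynomials have remainder \<open>0\<close>, each multiple
  can be rewritten by terms strictly below that degree (\<open>rewritable_homogeneous_relation\<close>).  Repeating this lowers the
  polynomial until its highest term is the leading term of \<open>h\<close>, whose exponent is then
  in the semigroup.
\<close>

section \<open>Coefficients and the adic topology\<close>

lemma mfps_nth_zero [simp]: "mfps_nth 0 \<beta> = 0"
  by (simp add: zero_mfps.rep_eq)

lemma mfps_nth_one: "mfps_nth 1 \<beta> = (if \<beta> = 0 then 1 else 0)"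
  by (simp add: one_mfps.rep_eq)

lemma mfps_nth_add [simp]: "mfps_nth (g + h) \<beta> = mfps_nth g \<beta> + mfps_nth h \<beta>"
  by (simp add: plus_mfps.rep_eq)

lemma mfps_nth_diff [simp]: "mfps_nth (g - h) \<beta> = mfps_nth g \<beta> - mfps_nth h \<beta>"
  by (simp add: minus_mfps.rep_eq)

lemma mfps_nth_sum: "mfps_nth (sum h I) \<beta> = (\<Sum>i\<in>I. mfps_nth (h i) \<beta>)"
  by (induction I rule: infinite_finite_induct) auto

lemma mfps_nth_monom: "mfps_nth (mfps_monom c \<alpha>) \<beta> = (if \<beta> = \<alpha> then c else 0)"
  by (simp add: mfps_monom.rep_eq)

lemma mfps_nth_mult:
  "mfps_nth (g * h) \<gamma> = (\<Sum>(\<alpha>, \<beta>) \<in> {(\<alpha>, \<beta>). \<alpha> + \<beta> = \<gamma>}. mfps_nth g \<alpha> * mfps_nth h \<beta>)"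
  by (simp add: times_mfps.rep_eq)

lemma mfps_nth_const_mult [simp]:
  fixes h :: "('a::comm_ring_1, 'b::finite) mfps"
  shows "mfps_nth (mfps_const c * h) \<gamma> = c * mfps_nth h \<gamma>"
proof -
  have "mfps_nth (mfps_const c * h) \<gamma> =
      (\<Sum>(\<alpha>, \<beta>) \<in> {(0 :: nat ^ 'b, \<gamma>)}. mfps_nth (mfps_const c) \<alpha> * mfps_nth h \<beta>)"
    unfolding mfps_nth_mult
    by (rule sum.mono_neutral_right)
      (auto simp: finite_exponent_pairs mfps_nth_monom split: if_splits)
  then show ?thesis by (simp add: mfps_nth_monom)
qed

lemma mfps_monom_mult: "mfps_monom c \<alpha> * mfps_monom d \<beta> = mfps_monom (c * d) (\<alpha> + \<beta>)"
proof (rule mfps_eqI)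
  fix \<gamma>
  have "mfps_nth (mfps_monom c \<alpha> * mfps_monom d \<beta>) \<gamma> =
      (\<Sum>p \<in> {(\<alpha>, \<beta>). \<alpha> + \<beta> = \<gamma>}. if p = (\<alpha>, \<beta>) then c * d else 0)"
    unfolding mfps_nth_mult by (rule sum.cong) (auto simp: mfps_nth_monom split: if_splits)
  also have "\<dots> = (if \<alpha> + \<beta> = \<gamma> then c * d else 0)"
    by (simp add: sum.delta finite_exponent_pairs)
  finally show "mfps_nth (mfps_monom c \<alpha> * mfps_monom d \<beta>) \<gamma> = mfps_nth (mfps_monom (c * d) (\<alpha> + \<beta>)) \<gamma>"
    by (auto simp: mfps_nth_monom)
qed

lemma mfps_const_add: "mfps_const (c + d) = mfps_const c + mfps_const d"
  by (rule mfps_eqI) (simp add: mfps_nth_monom)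

lemma mfps_const_one: "mfps_const 1 = 1"
  by (rule mfps_eqI) (simp add: mfps_nth_monom mfps_nth_one)

lemma finite_total_degree_less: "finite {\<beta> :: nat ^ 'n::finite. total_degree \<beta> < d}"
proof (rule finite_subset)
  show "{\<beta> :: nat ^ 'n. total_degree \<beta> < d} \<subseteq> {\<beta>. \<beta> \<le> (\<chi> i. d)}"
  proof
    fix \<beta> :: "nat ^ 'n" assume "\<beta> \<in> {\<beta>. total_degree \<beta> < d}"
    moreover have "\<beta> $ i \<le> total_degree \<beta>" for i
      unfolding total_degree_def by (rule member_le_sum) auto
    ultimately show "\<beta> \<in> {\<beta>. \<beta> \<le> (\<chi> i. d)}"
      by (auto simp: less_eq_vec_def) (meson less_imp_le_nat order_le_less_trans)
  qed
qed (rule finite_exponents_le)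

text \<open>Each basic adic neighbourhood prescribes only finitely many coefficients, and any finite set of
  coefficients can be prescribed by one.  The topology is therefore that of pointwise
  stabilisation of coefficients.\<close>

lemma open_mfps_agree_on:
  assumes "finite E"
  shows "open {g. \<forall>\<beta>\<in>E. mfps_nth g \<beta> = mfps_nth h \<beta>}"
proof -
  obtain d where "\<forall>\<beta>\<in>E. total_degree \<beta> < d"
    using assms by (metis finite_imageI finite_nat_set_iff_bounded imageI)
  then show ?thesis unfolding open_mfps_def by (auto intro!: exI[of _ d])
qed

lemma mem_closure_mfps_iff:
  "h \<in> closure B \<longleftrightarrow> (\<forall>E. finite E \<longrightarrow> (\<exists>g\<in>B. \<forall>\<beta>\<in>E. mfps_nth g \<beta> = mfps_nth h \<beta>))"
proof (intro iffI allI impI)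
  fix E :: "(nat ^ 'b) set" assume "h \<in> closure B" "finite E"
  then show "\<exists>g\<in>B. \<forall>\<beta>\<in>E. mfps_nth g \<beta> = mfps_nth h \<beta>"
    unfolding closure_iff_nhds_not_empty using open_mfps_agree_on[of E h] by blast
next
  assume R: "\<forall>E. finite E \<longrightarrow> (\<exists>g\<in>B. \<forall>\<beta>\<in>E. mfps_nth g \<beta> = mfps_nth h \<beta>)"
  show "h \<in> closure B" unfolding closure_iff_nhds_not_empty
  proof (intro allI impI)
    fix U S assume "S \<subseteq> U" "open S" "h \<in> S"
    then obtain d where "\<forall>g. (\<forall>\<beta>. total_degree \<beta> < d \<longrightarrow> mfps_nth g \<beta> = mfps_nth h \<beta>) \<longrightarrow> g \<in> U"
      unfolding open_mfps_def by blast
    moreover obtain g where "g \<in> B" "\<forall>\<beta>. total_degree \<beta> < d \<longrightarrow> mfps_nth g \<beta> = mfps_nth h \<beta>"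
      using R finite_total_degree_less[of d] by blast
    ultimately show "B \<inter> U \<noteq> {}" by blast
  qed
qed

lemma has_sum_mfps_iff:
  fixes g :: "'i \<Rightarrow> ('k::comm_ring_1, 'n::finite) mfps"
  shows "(g has_sum h) I \<longleftrightarrow> (\<forall>\<beta>. \<exists>X. finite X \<and> X \<subseteq> I \<and>
     (\<forall>Y. finite Y \<and> X \<subseteq> Y \<and> Y \<subseteq> I \<longrightarrow> (\<Sum>i\<in>Y. mfps_nth (g i) \<beta>) = mfps_nth h \<beta>))"
    (is "_ \<longleftrightarrow> (\<forall>\<beta>. ?fin \<beta>)")
proof (intro iffI allI)
  fix \<beta> assume "(g has_sum h) I"
  then have "\<forall>\<^sub>F Y in finite_subsets_at_top I. sum g Y \<in> {u. \<forall>x\<in>{\<beta>}. mfps_nth u x = mfps_nth h x}"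
    unfolding has_sum_def by (rule topological_tendstoD) (rule open_mfps_agree_on, simp_all)
  then show "?fin \<beta>" by (simp add: eventually_finite_subsets_at_top mfps_nth_sum)
next
  assume "\<forall>\<beta>. ?fin \<beta>"
  then have ev: "\<forall>\<^sub>F Y in finite_subsets_at_top I. mfps_nth (sum g Y) \<beta> = mfps_nth h \<beta>" for \<beta>
    by (simp add: eventually_finite_subsets_at_top mfps_nth_sum)
  show "(g has_sum h) I" unfolding has_sum_def
  proof (rule topological_tendstoI)
    fix U assume "open U" "h \<in> U"
    then obtain d where d: "\<And>u. \<forall>\<beta>\<in>{\<beta>. total_degree \<beta> < d}. mfps_nth u \<beta> = mfps_nth h \<beta> \<Longrightarrow> u \<in> U"
      unfolding open_mfps_def by blast
    have "\<forall>\<^sub>F Y in finite_subsets_at_top I.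
        \<forall>\<beta>\<in>{\<beta>. total_degree \<beta> < d}. mfps_nth (sum g Y) \<beta> = mfps_nth h \<beta>"
      by (rule eventually_ball_finite[OF finite_total_degree_less]) (simp add: ev)
    then show "\<forall>\<^sub>F Y in finite_subsets_at_top I. sum g Y \<in> U"
      by (rule eventually_mono) (rule d)
  qed
qed

section \<open>Substitution into polynomials\<close>

lemma mfps_power_prod_zero [simp]: "mfps_power_prod F 0 = 1"
  by (simp add: mfps_power_prod_def)

lemma mfps_power_prod_add: "mfps_power_prod F (\<alpha> + \<beta>) = mfps_power_prod F \<alpha> * mfps_power_prod F \<beta>"
  by (simp add: mfps_power_prod_def power_add prod.distrib)

lemma mfps_power_prod_axis: "mfps_power_prod F (axis i 1) = F i"
proof -
  have "F j ^ (axis i 1 $ j) = (if j = i then F i else 1)" for j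
    by (auto simp: axis_def)
  then show ?thesis by (simp add: mfps_power_prod_def)
qed

lemma mfps_subst_superset:
  fixes F :: "'s::finite \<Rightarrow> ('k::comm_ring_1, 'n::finite) mfps"
  assumes "finite T" "Poly_Mapping.keys p \<subseteq> T"
  shows "mfps_subst F p = (\<Sum>\<alpha>\<in>T. mfps_const (Poly_Mapping.lookup p \<alpha>) * mfps_power_prod F \<alpha>)"
proof -
  have "mfps_const (Poly_Mapping.lookup p \<alpha>) = (0 :: ('k, 'n) mfps)" if "\<alpha> \<in> T - Poly_Mapping.keys p" for \<alpha>
    using that by (intro mfps_eqI) (auto simp: mfps_nth_monom in_keys_iff)
  then show ?thesis
    unfolding mfps_subst_def by (intro sum.mono_neutral_left) (auto simp: assms)
qed

lemma mfps_nth_subst: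
  "mfps_nth (mfps_subst F p) \<beta> =
    (\<Sum>\<alpha>\<in>Poly_Mapping.keys p. Poly_Mapping.lookup p \<alpha> * mfps_nth (mfps_power_prod F \<alpha>) \<beta>)"
  by (simp add: mfps_subst_def mfps_nth_sum)

lemma mfps_subst_zero [simp]: "mfps_subst F 0 = 0"
  by (simp add: mfps_subst_def)

lemma mfps_subst_single:
  "mfps_subst F (Poly_Mapping.single \<alpha> c) = mfps_const c * mfps_power_prod F \<alpha>"
  by (subst mfps_subst_superset[of "{\<alpha>}"]) auto

lemma mfps_subst_add: "mfps_subst F (p + p') = mfps_subst F p + mfps_subst F p'"
proof -
  let ?T = "Poly_Mapping.keys p \<union> Poly_Mapping.keys p'"
  have T: "finite ?T" "Poly_Mapping.keys (p + p') \<subseteq> ?T"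
    using Poly_Mapping.keys_add[of p p'] by auto
  show ?thesis
    by (simp add: mfps_subst_superset[OF T] mfps_subst_superset[of ?T p] mfps_subst_superset[of ?T p']
        lookup_add mfps_const_add distrib_right sum.distrib)
qed

lemma mfps_subst_sum: "mfps_subst F (sum p I) = (\<Sum>i\<in>I. mfps_subst F (p i))"
  by (induction I rule: infinite_finite_induct) (auto simp: mfps_subst_add)

lemma mfps_subst_diff: "mfps_subst F (p - p') = mfps_subst F p - mfps_subst F p'"
  by (metis add_diff_cancel_right' diff_add_cancel mfps_subst_add)

lemma poly_mapping_sum_single:
  "p = (\<Sum>\<alpha>\<in>Poly_Mapping.keys p. Poly_Mapping.single \<alpha> (Poly_Mapping.lookup p \<alpha>))"
  by (rule poly_mapping_eqI)
    (auto simp: lookup_sum lookup_single when_def sum.delta in_keys_iff)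

lemma single_mult_eq_sum:
  "Poly_Mapping.single \<delta> c * p =
    (\<Sum>\<alpha>\<in>Poly_Mapping.keys p. Poly_Mapping.single (\<delta> + \<alpha>) (c * Poly_Mapping.lookup p \<alpha>))"
  by (subst poly_mapping_sum_single[of p]) (simp add: sum_distrib_left mult_single)

lemma lookup_single_mult_add:
  fixes p :: "(nat ^ 's::finite) \<Rightarrow>\<^sub>0 'k::comm_ring_1"
  shows "Poly_Mapping.lookup (Poly_Mapping.single \<delta> c * p) (\<delta> + \<alpha>) = c * Poly_Mapping.lookup p \<alpha>"
  by (auto simp: single_mult_eq_sum lookup_sum lookup_single when_def sum.delta in_keys_iff)

lemma mfps_subst_mult_single:
  "mfps_subst F (Poly_Mapping.single \<delta> c * p) = mfps_const c * mfps_power_prod F \<delta> * mfps_subst F p"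
proof -
  have "mfps_subst F (Poly_Mapping.single \<delta> c * p) =
      (\<Sum>\<alpha>\<in>Poly_Mapping.keys p. mfps_const c * mfps_power_prod F \<delta> *
         (mfps_const (Poly_Mapping.lookup p \<alpha>) * mfps_power_prod F \<alpha>))"
    unfolding single_mult_eq_sum mfps_subst_sum mfps_subst_single mfps_power_prod_add
    by (simp add: mult_ac flip: mfps_monom_mult[of c 0 _ 0, simplified])
  then show ?thesis by (simp add: mfps_subst_def sum_distrib_left)
qed

lemma mfps_subst_mult: "mfps_subst F (p * p') = mfps_subst F p * mfps_subst F p'"
proof -
  have "mfps_subst F (p * p') =
      mfps_subst F (\<Sum>\<alpha>\<in>Poly_Mapping.keys p. Poly_Mapping.single \<alpha> (Poly_Mapping.lookup p \<alpha>) * p')"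
    by (subst (1) poly_mapping_sum_single[of p]) (simp add: sum_distrib_right)
  also have "\<dots> = mfps_subst F p * mfps_subst F p'"
    by (simp add: mfps_subst_sum mfps_subst_mult_single)
       (simp add: mfps_subst_def sum_distrib_right)
  finally show ?thesis .
qed

lemma mfps_subalgebra_range_subst:
  fixes F :: "'s::finite \<Rightarrow> ('k::comm_ring_1, 'n::finite) mfps"
  shows "mfps_subalgebra (range (mfps_subst F))"
  unfolding mfps_subalgebra_def
proof (intro conjI ballI subsetI)
  fix g :: "('k, 'n) mfps" assume "g \<in> range mfps_const"
  then obtain c :: 'k where "g = mfps_const c" by blast
  then have "g = mfps_subst F (Poly_Mapping.single 0 c)" by (simp add: mfps_subst_single)
  then show "g \<in> range (mfps_subst F)" by blast
next
  fix g h assume "g \<in> range (mfps_subst F)" "h \<in> range (mfps_subst F)"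
  then obtain p p' where "g = mfps_subst F p" "h = mfps_subst F p'" by blast
  then have "g + h = mfps_subst F (p + p')" "g * h = mfps_subst F (p * p')"
    by (simp_all add: mfps_subst_add mfps_subst_mult)
  then show "g + h \<in> range (mfps_subst F)" "g * h \<in> range (mfps_subst F)" by blast+
qed

lemma mfps_subst_mem_subalgebra:
  assumes B: "mfps_subalgebra B" and F: "range F \<subseteq> B"
  shows "mfps_subst F p \<in> B"
proof -
  have const: "mfps_const c \<in> B" and mult: "g \<in> B \<Longrightarrow> h \<in> B \<Longrightarrow> g * h \<in> B"
    and add: "g \<in> B \<Longrightarrow> h \<in> B \<Longrightarrow> g + h \<in> B" for c g h
    using B by (auto simp: mfps_subalgebra_def)
  have one: "1 \<in> B" using const[of 1] by (simp add: mfps_const_one)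
  have zero: "0 \<in> B"
    using const[of 0] by (metis mfps_subst_single mfps_subst_zero mult.right_neutral single_zero mfps_power_prod_zero)
  have pow: "F i ^ n \<in> B" for i n
    by (induction n) (use F in \<open>auto intro: one mult\<close>)
  have "(\<Prod>i\<in>I. F i ^ (\<alpha> $ i)) \<in> B" for I \<alpha>
    by (induction I rule: infinite_finite_induct) (auto intro: one mult pow)
  then have prod_mem: "mfps_const c * mfps_power_prod F \<alpha> \<in> B" for c \<alpha>
    unfolding mfps_power_prod_def by (intro mult const)
  have "(\<Sum>\<alpha>\<in>T. mfps_const (c \<alpha>) * mfps_power_prod F \<alpha>) \<in> B" for c T
    by (induction T rule: infinite_finite_induct) (auto intro: zero add prod_mem)
  then show ?thesis unfolding mfps_subst_def by blast
qed

lemma subalgebra_hull_eq_range_subst: "mfps_subalgebra hull (range F) = range (mfps_subst F)"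
proof (rule hull_unique)
  show "range F \<subseteq> range (mfps_subst F)"
  proof safe
    fix i
    have "F i = mfps_subst F (Poly_Mapping.single (axis i 1) 1)"
      by (simp add: mfps_subst_single mfps_power_prod_axis mfps_const_one del: One_nat_def)
    then show "F i \<in> range (mfps_subst F)" by blast
  qed
qed (auto intro: mfps_subalgebra_range_subst mfps_subst_mem_subalgebra)

text \<open>A leading exponent is read off from finitely many coefficients, so
  polynomials in the generators suffice wherever leading exponents of the complete algebra
  are concerned.\<close>

lemma mem_complete_algebra_iff:
  "h \<in> complete_algebra (range F) \<longleftrightarrow>
    (\<forall>E. finite E \<longrightarrow> (\<exists>p. \<forall>\<beta>\<in>E. mfps_nth (mfps_subst F p) \<beta> = mfps_nth h \<beta>))"
  by (simp add: complete_algebra_def subalgebra_hull_eq_range_subst mem_closure_mfps_iff)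

lemma mfps_subst_mem_complete_algebra: "mfps_subst F p \<in> complete_algebra (range F)"
  by (auto simp: mem_complete_algebra_iff)

text \<open>Modulo finitely many coefficients a convergent series in the products of powers is a polynomial
  in the generators, obtained by cutting off its tail.  Arguments about such series thereby
  reduce to arguments about polynomials.\<close>

lemma has_sum_power_prods_truncate:
  fixes F :: "'s::finite \<Rightarrow> ('k::comm_ring_1, 'n::finite) mfps"
  assumes sum: "((\<lambda>\<alpha>. mfps_const (c \<alpha>) * mfps_power_prod F \<alpha>) has_sum h) UNIV" and "finite E"
  obtains p where "\<And>\<alpha>. \<alpha> \<in> Poly_Mapping.keys p \<Longrightarrow> c \<alpha> \<noteq> 0"
    and "\<And>\<beta>. \<beta> \<in> E \<Longrightarrow> mfps_nth (mfps_subst F p) \<beta> = mfps_nth h \<beta>"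
proof -
  have "\<forall>\<beta>. \<exists>X. finite X \<and> (\<forall>Y. finite Y \<and> X \<subseteq> Y \<longrightarrow>
      (\<Sum>\<alpha>\<in>Y. mfps_nth (mfps_const (c \<alpha>) * mfps_power_prod F \<alpha>) \<beta>) = mfps_nth h \<beta>)"
    using sum unfolding has_sum_mfps_iff by simp
  then obtain X where X: "\<forall>\<beta>. finite (X \<beta>) \<and> (\<forall>Y. finite Y \<and> X \<beta> \<subseteq> Y \<longrightarrow>
      (\<Sum>\<alpha>\<in>Y. mfps_nth (mfps_const (c \<alpha>) * mfps_power_prod F \<alpha>) \<beta>) = mfps_nth h \<beta>)"
    by (rule choice[THEN exE])
  define Y where "Y = (\<Union>\<beta>\<in>E. X \<beta>)"
  have Y: "finite Y" using X \<open>finite E\<close> by (auto simp: Y_def)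
  define p where "p = (\<Sum>\<alpha>\<in>Y. Poly_Mapping.single \<alpha> (c \<alpha>))"
  show thesis
  proof (rule that)
    show "c \<alpha> \<noteq> 0" if "\<alpha> \<in> Poly_Mapping.keys p" for \<alpha>
      using that Y
      by (auto simp: p_def in_keys_iff lookup_sum lookup_single when_def sum.delta split: if_splits)
    show "mfps_nth (mfps_subst F p) \<beta> = mfps_nth h \<beta>" if "\<beta> \<in> E" for \<beta>
    proof -
      have "X \<beta> \<subseteq> Y" using that by (auto simp: Y_def)
      then have "(\<Sum>\<alpha>\<in>Y. mfps_nth (mfps_const (c \<alpha>) * mfps_power_prod F \<alpha>) \<beta>) = mfps_nth h \<beta>"
        using X Y by blast
      then show ?thesis by (simp add: p_def mfps_subst_sum mfps_subst_single mfps_nth_sum)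
    qed
  qed
qed

lemma has_sum_power_prods_mem_complete_algebra:
  fixes F :: "'s::finite \<Rightarrow> ('k::comm_ring_1, 'n::finite) mfps"
  assumes "((\<lambda>\<alpha>. mfps_const (c \<alpha>) * mfps_power_prod F \<alpha>) has_sum h) UNIV"
  shows "h \<in> complete_algebra (range F)"
  unfolding mem_complete_algebra_iff by (meson assms has_sum_power_prods_truncate)

lemma complete_algebra_diff:
  fixes F :: "'s::finite \<Rightarrow> ('k::comm_ring_1, 'n::finite) mfps"
  assumes "g \<in> complete_algebra (range F)" "h \<in> complete_algebra (range F)"
  shows "g - h \<in> complete_algebra (range F)"
  unfolding mem_complete_algebra_iff
proof (intro allI impI)
  fix E :: "(nat ^ 'n) set" assume "finite E"
  then obtain p p' where "\<forall>\<beta>\<in>E. mfps_nth (mfps_subst F p) \<beta> = mfps_nth g \<beta>"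
      "\<forall>\<beta>\<in>E. mfps_nth (mfps_subst F p') \<beta> = mfps_nth h \<beta>"
    using assms unfolding mem_complete_algebra_iff by metis
  then show "\<exists>u. \<forall>\<beta>\<in>E. mfps_nth (mfps_subst F u) \<beta> = mfps_nth (g - h) \<beta>"
    by (intro exI[of _ "p - p'"]) (simp add: mfps_subst_diff)
qed

section \<open>Leading exponents\<close>

lemma max_wrt_eqI:
  assumes "antisym r" "m \<in> S" "\<And>x. x \<in> S \<Longrightarrow> (x, m) \<in> r"
  shows "max_wrt r S = m"
  unfolding max_wrt_def using assms by (auto intro!: the_equality dest: antisymD)

lemma finite_linear_order_has_max:
  assumes r: "linear_order_on UNIV r" and "finite S" "S \<noteq> {}"
  shows "\<exists>m\<in>S. \<forall>x\<in>S. (x, m) \<in> r"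
  using assms(2,3)
proof (induction S rule: finite_ne_induct)
  case (singleton x)
  then show ?case using r by (auto simp: order_on_defs refl_on_def)
next
  case (insert x S)
  then obtain m where m: "m \<in> S" "\<forall>y\<in>S. (y, m) \<in> r" by blast
  have xx: "(x, x) \<in> r" and tot: "(x, m) \<in> r \<or> (m, x) \<in> r" and tr: "trans r"
    using r by (cases "x = m"; auto simp: order_on_defs refl_on_def total_on_def)+
  show ?case using tot
  proof
    assume "(x, m) \<in> r" then show ?thesis using m by blast
  next
    assume "(m, x) \<in> r"
    then have "\<forall>y\<in>insert x S. (y, x) \<in> r" using m xx tr by (auto dest: transD)
    then show ?thesis by blast
  qed
qed

lemma max_wrt_finite:
  assumes r: "linear_order_on UNIV r" and S: "finite S" "S \<noteq> {}"
  shows "max_wrt r S \<in> S" and "x \<in> S \<Longrightarrow> (x, max_wrt r S) \<in> r"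
proof -
  obtain m where m: "m \<in> S" "\<forall>x\<in>S. (x, m) \<in> r"
    using finite_linear_order_has_max[OF assms] by blast
  moreover have "max_wrt r S = m"
    using r m by (intro max_wrt_eqI) (auto simp: order_on_defs)
  ultimately show "max_wrt r S \<in> S" and "x \<in> S \<Longrightarrow> (x, max_wrt r S) \<in> r" by auto
qed

lemma compatible_well_orderD:
  assumes "compatible_well_order r"
  shows "linear_order_on UNIV r" "antisym r" "trans r" "(\<alpha>, \<alpha>) \<in> r"
    "(\<alpha>, \<beta>) \<in> r \<or> (\<beta>, \<alpha>) \<in> r" "wf (r - Id)" "(\<alpha>, \<beta>) \<in> r \<Longrightarrow> (\<alpha> + \<gamma>, \<beta> + \<gamma>) \<in> r"
proof -
  show *: "linear_order_on UNIV r" and "wf (r - Id)" and "(\<alpha>, \<beta>) \<in> r \<Longrightarrow> (\<alpha> + \<gamma>, \<beta> + \<gamma>) \<in> r"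
    using assms by (auto simp: compatible_well_order_def well_order_on_def)
  show "antisym r" "trans r" "(\<alpha>, \<alpha>) \<in> r" using * by (auto simp: order_on_defs refl_on_def)
  show "(\<alpha>, \<beta>) \<in> r \<or> (\<beta>, \<alpha>) \<in> r"
    using * by (cases "\<alpha> = \<beta>") (auto simp: order_on_defs refl_on_def total_on_def)
qed

text \<open>A compatible well order refines divisibility: if some \<open>\<delta>\<close> were smaller than
  \<open>0\<close>, its multiples would form an infinite descending chain.\<close>

lemma compatible_well_order_nonneg:
  assumes r: "compatible_well_order r"
  shows "(0, \<delta>) \<in> r"
proof (rule ccontr)
  assume "(0, \<delta>) \<notin> r"
  then have neg: "(\<delta>, 0) \<in> r" "\<delta> \<noteq> 0" using compatible_well_orderD[OF r] by metis+
  define m where "m k = of_nat k * \<delta>" for k :: nat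
  have m_Suc: "m (Suc k) = \<delta> + m k" for k by (simp add: m_def distrib_right)
  have "(m (Suc k), m k) \<in> r - Id" for k
    using compatible_well_orderD(7)[OF r neg(1), of "m k"] neg(2) by (simp add: m_Suc)
  then show False using compatible_well_orderD(6)[OF r] by (auto simp: wf_iff_no_infinite_down_chain)
qed

lemma vec_le_imp_add:
  assumes "\<alpha> \<le> (\<beta> :: nat ^ 's::finite)"
  obtains \<delta> where "\<beta> = \<delta> + \<alpha>"
proof
  show "\<beta> = (\<chi> i. \<beta> $ i - \<alpha> $ i) + \<alpha>"
    using assms by (auto simp: vec_eq_iff less_eq_vec_def)
qed

lemma compatible_well_order_of_le:
  assumes "compatible_well_order r" "\<alpha> \<le> \<beta>"
  shows "(\<alpha>, \<beta>) \<in> r"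
proof -
  obtain \<delta> where "\<beta> = \<delta> + \<alpha>" using assms(2) by (rule vec_le_imp_add)
  then show ?thesis
    using compatible_well_orderD(7)[OF assms(1) compatible_well_order_nonneg[OF assms(1), of \<delta>], of \<alpha>] by simp
qed

lemma poly_lead_exp_props:
  assumes "compatible_well_order q" "p \<noteq> 0"
  shows "poly_lead_exp q p \<in> Poly_Mapping.keys p"
    and "\<alpha> \<in> Poly_Mapping.keys p \<Longrightarrow> (\<alpha>, poly_lead_exp q p) \<in> q"
  using max_wrt_finite[OF compatible_well_orderD(1)[OF assms(1)] finite_keys, of p] assms(2)
  by (auto simp: poly_lead_exp_def)

locale weighted_order =
  fixes r :: "(nat ^ 'n::finite) rel" and a :: "rat ^ 'n"
  assumes r: "compatible_well_order r"
    and a_pos: "a $ i > 0"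
begin

abbreviation le (infix "\<sqsubseteq>" 50) where "\<beta> \<sqsubseteq> \<gamma> \<equiv> (\<beta>, \<gamma>) \<in> weight_order r a"
abbreviation less (infix "\<sqsubset>" 50) where "\<beta> \<sqsubset> \<gamma> \<equiv> \<beta> \<sqsubseteq> \<gamma> \<and> \<beta> \<noteq> \<gamma>"

sublocale ord: linorder le less
proof
  note * = compatible_well_orderD[OF r]
  fix \<alpha> \<beta> \<gamma>
  show "(\<alpha> \<sqsubset> \<beta>) = (\<alpha> \<sqsubseteq> \<beta> \<and> \<not> \<beta> \<sqsubseteq> \<alpha>)"
    using *(2,4) by (auto simp: weight_order_def dest: antisymD)
  show "\<alpha> \<sqsubseteq> \<alpha>" using *(4) by (simp add: weight_order_def)
  show "\<alpha> \<sqsubseteq> \<gamma>" if "\<alpha> \<sqsubseteq> \<beta>" "\<beta> \<sqsubseteq> \<gamma>" using that *(3) by (auto simp: weight_order_def dest: transD)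
  show "\<alpha> = \<beta>" if "\<alpha> \<sqsubseteq> \<beta>" "\<beta> \<sqsubseteq> \<alpha>" using that *(2) by (auto simp: weight_order_def dest: antisymD)
  show "\<alpha> \<sqsubseteq> \<beta> \<or> \<beta> \<sqsubseteq> \<alpha>" using *(5)[of \<alpha> \<beta>] by (auto simp: weight_order_def)
qed

lemma weight_add: "weight a (\<alpha> + \<beta>) = weight a \<alpha> + weight a \<beta>"
  by (simp add: weight_def distrib_left sum.distrib)

lemma weight_nonneg: "weight a \<alpha> \<ge> 0"
  unfolding weight_def by (intro sum_nonneg mult_nonneg_nonneg) (auto intro: less_imp_le a_pos)

lemma weight_antimono: "\<beta> \<sqsubseteq> \<gamma> \<Longrightarrow> weight a \<gamma> \<le> weight a \<beta>"
  by (auto simp: weight_order_def)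

lemma le_add_right: "\<beta> \<sqsubseteq> \<gamma> \<Longrightarrow> \<beta> + \<delta> \<sqsubseteq> \<gamma> + \<delta>"
  using compatible_well_orderD(7)[OF r] by (auto simp: weight_order_def weight_add)

lemma less_add_right: "\<beta> \<sqsubset> \<gamma> \<Longrightarrow> \<beta> + \<delta> \<sqsubset> \<gamma> + \<delta>"
  using le_add_right by auto

lemma add_mono_le:
  assumes "\<beta> \<sqsubseteq> \<gamma>" "\<beta>' \<sqsubseteq> \<gamma>'"
  shows "\<beta> + \<beta>' \<sqsubseteq> \<gamma> + \<gamma>'"
proof (rule ord.order.trans)
  show "\<beta> + \<beta>' \<sqsubseteq> \<gamma> + \<beta>'" using assms(1) by (rule le_add_right)
  show "\<gamma> + \<beta>' \<sqsubseteq> \<gamma> + \<gamma>'" using le_add_right[OF assms(2), of \<gamma>] by (simp add: add.commute)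
qed

lemma add_mono_le_eqD:
  assumes "\<beta> \<sqsubseteq> \<gamma>" "\<beta>' \<sqsubseteq> \<gamma>'" "\<beta> + \<beta>' = \<gamma> + \<gamma>'"
  shows "\<beta> = \<gamma> \<and> \<beta>' = \<gamma>'"
proof -
  have "\<gamma> + \<beta>' \<sqsubseteq> \<gamma> + \<gamma>'" "\<gamma> + \<gamma>' \<sqsubseteq> \<gamma> + \<beta>'"
    using le_add_right[OF assms(2), of \<gamma>] le_add_right[OF assms(1), of \<beta>'] assms(3)
    by (simp_all add: add.commute)
  then show ?thesis using assms(3) by (metis add_left_cancel add_right_cancel ord.order.antisym)
qed

lemma finite_weight_le: "finite {\<beta>. weight a \<beta> \<le> N}"
proof (rule finite_subset)
  show "{\<beta>. weight a \<beta> \<le> N} \<subseteq> {\<beta>. \<beta> \<le> (\<chi> i. nat \<lfloor>N / a $ i\<rfloor>)}"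
  proof safe
    fix \<beta> assume N: "weight a \<beta> \<le> N"
    have "\<beta> $ i \<le> nat \<lfloor>N / a $ i\<rfloor>" for i
    proof -
      have "a $ i * of_nat (\<beta> $ i) \<le> weight a \<beta>" unfolding weight_def
        by (rule member_le_sum) (auto intro!: mult_nonneg_nonneg simp: less_imp_le a_pos)
      then have "of_nat (\<beta> $ i) \<le> N / a $ i"
        using N a_pos[of i] by (simp add: pos_le_divide_eq mult.commute)
      then show ?thesis by (simp add: le_floor_iff le_nat_iff)
    qed
    then show "\<beta> \<le> (\<chi> i. nat \<lfloor>N / a $ i\<rfloor>)" by (simp add: less_eq_vec_def)
  qed
qed (rule finite_exponents_le)

text \<open>Since the weights are positive, only finitely many exponents lie above a given one:
  reversed, the order has type \<open>\<omega>\<close>.  This is what makes every rewriting below converge.\<close>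

lemma finite_above: "finite {\<gamma>. \<beta> \<sqsubseteq> \<gamma>}"
  by (rule finite_subset[OF _ finite_weight_le[of "weight a \<beta>"]]) (auto dest: weight_antimono)

lemma wf_above: "wf {(\<gamma>, \<beta>). \<beta> \<sqsubset> \<gamma>}"
proof (rule wf_subset[OF wf_measure[where f = "\<lambda>\<beta>. card {\<gamma>. \<beta> \<sqsubseteq> \<gamma>}"]], safe)
  fix \<gamma> \<beta> assume "\<beta> \<sqsubseteq> \<gamma>" "\<beta> \<noteq> \<gamma>"
  then have "{\<delta>. \<gamma> \<sqsubseteq> \<delta>} \<subset> {\<delta>. \<beta> \<sqsubseteq> \<delta>}" by (auto intro: ord.order.trans ord.order.antisym)
  then show "(\<gamma>, \<beta>) \<in> Wellfounded.measure (\<lambda>\<beta>. card {\<gamma>. \<beta> \<sqsubseteq> \<gamma>})"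
    by (simp add: psubset_card_mono finite_above)
qed

lemma lead_exp_eqI:
  assumes \<gamma>: "mfps_nth g \<gamma> \<noteq> 0" and top: "\<And>\<beta>. mfps_nth g \<beta> \<noteq> 0 \<Longrightarrow> \<beta> \<sqsubseteq> \<gamma>"
  shows "lead_exp r a g = \<gamma>"
proof -
  have "initial_weight a g = weight a \<gamma>" unfolding initial_weight_def
    by (rule Least_equality) (use assms in \<open>auto simp: mfps_supp_def dest: weight_antimono\<close>)
  then have "mfps_supp (initial_form a g) = {\<beta>. mfps_nth g \<beta> \<noteq> 0 \<and> weight a \<beta> = weight a \<gamma>}"
    by (auto simp: mfps_supp_def initial_form_def Abs_mfps_inverse)
  then show ?thesis unfolding lead_exp_def
    using \<gamma> compatible_well_orderD(2)[OF r]
    by (intro max_wrt_eqI) (auto simp: weight_order_def dest!: top)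
qed

lemma exists_lead_exp:
  fixes g :: "('k::comm_ring_1, 'n) mfps"
  assumes "g \<noteq> 0"
  obtains \<gamma> where "mfps_nth g \<gamma> \<noteq> 0" "\<And>\<beta>. mfps_nth g \<beta> \<noteq> 0 \<Longrightarrow> \<beta> \<sqsubseteq> \<gamma>"
proof -
  obtain \<beta> where \<beta>: "mfps_nth g \<beta> \<noteq> 0" using assms by (metis mfps_eqI mfps_nth_zero)
  define S where "S = {\<gamma>. \<beta> \<sqsubseteq> \<gamma> \<and> mfps_nth g \<gamma> \<noteq> 0}"
  have S: "finite S" "S \<noteq> {}" using \<beta> finite_above[of \<beta>] by (auto simp: S_def)
  show thesis
  proof (rule that)
    have "ord.Max S \<in> S" using S by (rule ord.Max_in)
    then show "mfps_nth g (ord.Max S) \<noteq> 0" by (simp add: S_def)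
    fix \<gamma> assume \<gamma>: "mfps_nth g \<gamma> \<noteq> 0"
    show "\<gamma> \<sqsubseteq> ord.Max S"
    proof (cases "\<beta> \<sqsubseteq> \<gamma>")
      case True
      then show ?thesis using S(1) \<gamma> by (intro ord.Max_ge) (auto simp: S_def)
    next
      case False
      then have "\<gamma> \<sqsubseteq> \<beta>" by (rule ord.nle_le[THEN iffD1, THEN conjunct1])
      moreover have "\<beta> \<sqsubseteq> ord.Max S" using S(1) \<beta> by (intro ord.Max_ge) (auto simp: S_def)
      ultimately show ?thesis by (rule ord.order.trans)
    qed
  qed
qed

lemma mfps_nth_lead_exp: "g \<noteq> 0 \<Longrightarrow> mfps_nth g (lead_exp r a g) \<noteq> 0"
  by (erule exists_lead_exp) (metis lead_exp_eqI)

lemma le_lead_exp: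
  fixes g :: "('k::comm_ring_1, 'n) mfps"
  assumes "mfps_nth g \<beta> \<noteq> 0"
  shows "\<beta> \<sqsubseteq> lead_exp r a g"
proof -
  have "g \<noteq> 0" using assms by auto
  then obtain \<gamma> where \<gamma>: "mfps_nth g \<gamma> \<noteq> 0" "\<And>\<beta>. mfps_nth g \<beta> \<noteq> 0 \<Longrightarrow> \<beta> \<sqsubseteq> \<gamma>"
    by (rule exists_lead_exp) blast
  then have "lead_exp r a g = \<gamma>" by (rule lead_exp_eqI)
  then show ?thesis using \<gamma>(2) assms by simp
qed

text \<open>A form of ``monic with leading exponent \<open>\<gamma>\<close>'' that avoids the description operators in the
  definition of the leading exponent and is visibly stable under products.\<close>

definition monic_at :: "('k::comm_ring_1, 'n) mfps \<Rightarrow> nat ^ 'n \<Rightarrow> bool" where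
  "monic_at g \<gamma> \<longleftrightarrow> mfps_nth g \<gamma> = 1 \<and> (\<forall>\<beta>. mfps_nth g \<beta> \<noteq> 0 \<longrightarrow> \<beta> \<sqsubseteq> \<gamma>)"

lemma lead_exp_monic_at: "monic_at g \<gamma> \<Longrightarrow> lead_exp r a g = \<gamma>"
  by (rule lead_exp_eqI) (auto simp: monic_at_def)

lemma monic_at_monom: "monic_at (mfps_monom 1 \<gamma>) \<gamma>"
  by (auto simp: monic_at_def mfps_nth_monom)

lemma monic_at_one: "monic_at 1 0"
  by (auto simp: monic_at_def mfps_nth_one)

text \<open>Leading terms multiply: the only way to write the sum of two leading exponents
  as a sum of exponents from the two supports is the obvious one.\<close>

lemma monic_at_mult:
  assumes g: "monic_at g \<gamma>" and h: "monic_at h \<delta>"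
  shows "monic_at (g * h) (\<gamma> + \<delta>)"
  unfolding monic_at_def
proof (intro conjI allI impI)
  have "mfps_nth (g * h) (\<gamma> + \<delta>) = (\<Sum>(\<alpha>, \<beta>) \<in> {(\<gamma>, \<delta>)}. mfps_nth g \<alpha> * mfps_nth h \<beta>)"
    unfolding mfps_nth_mult
  proof (rule sum.mono_neutral_right, rule finite_exponent_pairs)
    show "\<forall>p\<in>{(\<alpha>, \<beta>). \<alpha> + \<beta> = \<gamma> + \<delta>} - {(\<gamma>, \<delta>)}. (case p of (\<alpha>, \<beta>) \<Rightarrow> mfps_nth g \<alpha> * mfps_nth h \<beta>) = 0"
    proof safe
      fix \<alpha> \<beta> assume *: "\<alpha> + \<beta> = \<gamma> + \<delta>" and "mfps_nth g \<alpha> * mfps_nth h \<beta> \<noteq> 0"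
      then have "mfps_nth g \<alpha> \<noteq> 0" "mfps_nth h \<beta> \<noteq> 0" by auto
      then have "\<alpha> \<sqsubseteq> \<gamma>" "\<beta> \<sqsubseteq> \<delta>" using g h by (auto simp: monic_at_def)
      then show "\<alpha> = \<gamma>" "\<beta> = \<delta>" using add_mono_le_eqD[OF _ _ *] by auto
    qed
  qed auto
  then show "mfps_nth (g * h) (\<gamma> + \<delta>) = 1" using g h by (simp add: monic_at_def)
next
  fix \<beta> assume "mfps_nth (g * h) \<beta> \<noteq> 0"
  then have "(\<Sum>x | fst x + snd x = \<beta>. mfps_nth g (fst x) * mfps_nth h (snd x)) \<noteq> 0"
    by (simp add: mfps_nth_mult split_def)
  then obtain x where x: "fst x + snd x = \<beta>" "mfps_nth g (fst x) * mfps_nth h (snd x) \<noteq> 0"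
    by (rule sum.not_neutral_contains_not_neutral) blast
  then have "mfps_nth g (fst x) \<noteq> 0" "mfps_nth h (snd x) \<noteq> 0" by auto
  then have "fst x + snd x \<sqsubseteq> \<gamma> + \<delta>" using g h by (intro add_mono_le) (auto simp: monic_at_def)
  then show "\<beta> \<sqsubseteq> \<gamma> + \<delta>" using x by auto
qed

text \<open>If every exponent is the leading exponent of a chosen monic series, any series expands along the
  chosen ones: the coefficients solve a unitriangular system, by recursion downwards along the
  order.\<close>

lemma unitriangular_expansion:
  fixes b :: "nat ^ 'n \<Rightarrow> ('k::comm_ring_1, 'n) mfps"
  assumes b: "\<And>\<gamma>. monic_at (b \<gamma>) \<gamma>"
  obtains t where "\<And>\<beta>. mfps_nth h \<beta> = (\<Sum>\<gamma> | \<beta> \<sqsubseteq> \<gamma>. t \<gamma> * mfps_nth (b \<gamma>) \<beta>)"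
proof
  define R where "R = {(\<gamma>, \<beta>). \<beta> \<sqsubset> \<gamma>}"
  define \<Phi> where "\<Phi> t \<beta> = mfps_nth h \<beta> - (\<Sum>\<gamma> | \<beta> \<sqsubset> \<gamma>. t \<gamma> * mfps_nth (b \<gamma>) \<beta>)" for t \<beta>
  define t where "t = wfrec R \<Phi>"
  have t: "t \<beta> = mfps_nth h \<beta> - (\<Sum>\<gamma> | \<beta> \<sqsubset> \<gamma>. t \<gamma> * mfps_nth (b \<gamma>) \<beta>)" for \<beta>
  proof -
    have "t \<beta> = \<Phi> (cut t R \<beta>) \<beta>" unfolding t_def by (rule wfrec) (simp add: R_def wf_above)
    also have "\<dots> = \<Phi> t \<beta>" unfolding \<Phi>_def by (auto intro!: sum.cong simp: R_def cut_apply)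
    finally show ?thesis by (simp add: \<Phi>_def)
  qed
  fix \<beta>
  have "{\<gamma>. \<beta> \<sqsubseteq> \<gamma>} = insert \<beta> {\<gamma>. \<beta> \<sqsubset> \<gamma>}" by auto
  moreover have "finite {\<gamma>. \<beta> \<sqsubset> \<gamma>}" by (rule finite_subset[OF _ finite_above[of \<beta>]]) auto
  ultimately have "(\<Sum>\<gamma> | \<beta> \<sqsubseteq> \<gamma>. t \<gamma> * mfps_nth (b \<gamma>) \<beta>) =
      t \<beta> * mfps_nth (b \<beta>) \<beta> + (\<Sum>\<gamma> | \<beta> \<sqsubset> \<gamma>. t \<gamma> * mfps_nth (b \<gamma>) \<beta>)" by simp
  also have "\<dots> = mfps_nth h \<beta>" using b[of \<beta>] by (subst (1) t) (simp add: monic_at_def)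
  finally show "mfps_nth h \<beta> = (\<Sum>\<gamma> | \<beta> \<sqsubseteq> \<gamma>. t \<gamma> * mfps_nth (b \<gamma>) \<beta>)" ..
qed

end

section \<open>Products of powers of a monic family\<close>

locale monic_family = weighted_order r a
  for r :: "(nat ^ 'n::finite) rel" and a +
  fixes f :: "'s::finite \<Rightarrow> ('k::field, 'n) mfps"
  assumes monic: "monic_at (f i) (lead_exp r a (f i))"
begin

abbreviation lead_monoid :: "(nat ^ 'n) set" where
  "lead_monoid \<equiv> add_submonoid hull (range (\<lambda>i. lead_exp r a (f i)))"

abbreviation prod_exp :: "nat ^ 's \<Rightarrow> nat ^ 'n" where
  "prod_exp \<alpha> \<equiv> lead_exp r a (mfps_power_prod f \<alpha>)"

lemma add_submonoid_lead_monoid: "add_submonoid lead_monoid"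
  by (rule hull_in) (auto simp: add_submonoid_def)

text \<open>The three facts are carried through the product by one induction: each of them is
  stable under multiplication because leading exponents add.\<close>

lemma power_prod_lead:
  "\<exists>\<gamma>\<in>lead_monoid. monic_at (mfps_power_prod f \<alpha>) \<gamma> \<and>
     mfps_power_prod (\<lambda>i. lead_monomial r a (f i)) \<alpha> = mfps_monom 1 \<gamma>"
proof -
  define Q where "Q g g' \<longleftrightarrow> (\<exists>\<gamma>\<in>lead_monoid. monic_at g \<gamma> \<and> g' = mfps_monom 1 \<gamma>)"
    for g g' :: "('k, 'n) mfps"
  have one: "Q 1 1"
    using add_submonoid_lead_monoid monic_at_one
    by (auto simp: Q_def add_submonoid_def mfps_const_one)
  have mult: "Q (g * h) (g' * h')" if "Q g g'" "Q h h'" for g g' h h'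
  proof -
    from that obtain \<gamma> \<delta> where "\<gamma> \<in> lead_monoid" "\<delta> \<in> lead_monoid" "monic_at g \<gamma>" "monic_at h \<delta>"
      "g' = mfps_monom 1 \<gamma>" "h' = mfps_monom 1 \<delta>" unfolding Q_def by blast
    then show ?thesis
      unfolding Q_def using add_submonoid_lead_monoid
      by (intro bexI[of _ "\<gamma> + \<delta>"]) (auto simp: monic_at_mult mfps_monom_mult add_submonoid_def)
  qed
  have base: "Q (f i) (lead_monomial r a (f i))" for i
    using monic[of i] by (auto simp: Q_def lead_monomial_def monic_at_def intro!: bexI hull_inc)
  have pow: "Q (f i ^ n) (lead_monomial r a (f i) ^ n)" for i n
    by (induction n) (auto intro: one mult base)
  have "Q (\<Prod>i\<in>I. f i ^ (\<alpha> $ i)) (\<Prod>i\<in>I. lead_monomial r a (f i) ^ (\<alpha> $ i))" for I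
    by (induction I rule: infinite_finite_induct) (auto intro: one mult pow)
  then show ?thesis by (simp add: Q_def mfps_power_prod_def)
qed

lemma monic_at_power_prod: "monic_at (mfps_power_prod f \<alpha>) (prod_exp \<alpha>)"
  using power_prod_lead[of \<alpha>] lead_exp_monic_at by auto

lemma power_prod_lead_monomial:
  "mfps_power_prod (\<lambda>i. lead_monomial r a (f i)) \<alpha> = mfps_monom 1 (prod_exp \<alpha>)"
  using power_prod_lead[of \<alpha>] lead_exp_monic_at by auto

lemma prod_exp_add: "prod_exp (\<alpha> + \<beta>) = prod_exp \<alpha> + prod_exp \<beta>"
  unfolding mfps_power_prod_add
  by (intro lead_exp_monic_at monic_at_mult monic_at_power_prod)

lemma le_prod_exp: "mfps_nth (mfps_power_prod f \<alpha>) \<beta> \<noteq> 0 \<Longrightarrow> \<beta> \<sqsubseteq> prod_exp \<alpha>"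
  by (rule le_lead_exp)

lemma nth_power_prod_prod_exp: "mfps_nth (mfps_power_prod f \<alpha>) (prod_exp \<alpha>) = 1"
  using monic_at_power_prod by (simp add: monic_at_def)

lemma range_prod_exp: "range prod_exp = lead_monoid"
proof
  show "range prod_exp \<subseteq> lead_monoid"
    using power_prod_lead lead_exp_monic_at by blast
  show "lead_monoid \<subseteq> range prod_exp"
  proof (rule hull_minimal)
    show "range (\<lambda>i. lead_exp r a (f i)) \<subseteq> range prod_exp"
      by (metis image_subset_iff mfps_power_prod_axis rangeI)
    have "prod_exp 0 = 0" using lead_exp_monic_at[OF monic_at_one] by simp
    then show "add_submonoid (range prod_exp)"
      by (force simp: add_submonoid_def simp flip: prod_exp_add intro: range_eqI[of _ _ 0])
  qed
qed

lemma lead_monoid_subset_lead_exps: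
  "lead_monoid \<subseteq> lead_exps r a (complete_algebra (range f))"
proof
  fix \<gamma> assume "\<gamma> \<in> lead_monoid"
  then obtain \<alpha> where \<gamma>: "\<gamma> = prod_exp \<alpha>" unfolding range_prod_exp[symmetric] by blast
  have "mfps_subst f (Poly_Mapping.single \<alpha> 1) = mfps_power_prod f \<alpha>"
    by (simp add: mfps_subst_single mfps_const_one)
  then have "mfps_power_prod f \<alpha> \<in> complete_algebra (range f)"
    by (metis mfps_subst_mem_complete_algebra)
  moreover have "mfps_power_prod f \<alpha> \<noteq> 0"
    using nth_power_prod_prod_exp[of \<alpha>] by auto
  ultimately show "\<gamma> \<in> lead_exps r a (complete_algebra (range f))"
    unfolding lead_exps_def \<gamma> by blast
qed

text \<open>The leading exponents of the products of powers are attained in the complete algebra, so only one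
  of the two inclusions between the semigroups is in question.\<close>

lemma canonical_basis_iff:
  "canonical_basis r a (complete_algebra (range f)) (range f) \<longleftrightarrow>
    lead_exps r a (complete_algebra (range f)) \<subseteq> lead_monoid"
proof -
  have "f i \<in> complete_algebra (range f)" for i
    unfolding complete_algebra_def by (rule closure_subset[THEN subsetD]) (simp add: hull_inc)
  moreover have "f i \<noteq> 0" for i using monic[of i] by (auto simp: monic_at_def)
  ultimately show ?thesis
    using lead_monoid_subset_lead_exps by (auto simp: canonical_basis_def image_image)
qed

section \<open>Remainders\<close>

text \<open>Attach to each exponent \<open>\<gamma>\<close> a monic series \<open>b \<gamma>\<close> with that leading exponent:
  a product of powers of the family if \<open>\<gamma>\<close> lies in the semigroup of its leading exponents,
  the bare monomial otherwise.  In the expansion of \<open>P\<close> along the \<open>b \<gamma>\<close> the terms of the first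
  kind add up to \<open>H\<close>, those of the second kind to the remainder.  No two terms share a leading
  exponent, which yields the uniqueness demanded when the remainder vanishes.\<close>

lemma exists_remainder: "\<exists>R. is_remainder r a f P R"
proof (cases "P = 0")
  case False
  define \<sigma> where "\<sigma> \<gamma> = (SOME \<alpha>. prod_exp \<alpha> = \<gamma>)" for \<gamma>
  have \<sigma>: "prod_exp (\<sigma> \<gamma>) = \<gamma>" if "\<gamma> \<in> lead_monoid" for \<gamma>
  proof -
    have "\<gamma> \<in> range prod_exp" by (simp only: range_prod_exp that)
    then have "\<exists>\<alpha>. prod_exp \<alpha> = \<gamma>" by blast
    then show ?thesis unfolding \<sigma>_def by (rule someI_ex)
  qed
  define b where "b \<gamma> = (if \<gamma> \<in> lead_monoid then mfps_power_prod f (\<sigma> \<gamma>) else mfps_monom 1 \<gamma>)" for \<gamma>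
  have b: "monic_at (b \<gamma>) \<gamma>" for \<gamma>
    unfolding b_def using monic_at_power_prod[of "\<sigma> \<gamma>"] \<sigma> by (auto simp: monic_at_monom)
  obtain t where t: "\<And>\<beta>. mfps_nth P \<beta> = (\<Sum>\<gamma> | \<beta> \<sqsubseteq> \<gamma>. t \<gamma> * mfps_nth (b \<gamma>) \<beta>)"
    using unitriangular_expansion[of b P] b by blast
  define R where "R = Abs_mfps (\<lambda>\<beta>. if \<beta> \<in> lead_monoid then 0 else t \<beta>)"
  have R: "mfps_nth R \<beta> = (if \<beta> \<in> lead_monoid then 0 else t \<beta>)" for \<beta>
    by (simp add: R_def Abs_mfps_inverse)
  define H where "H = P - R"
  define c where "c \<alpha> = (if \<sigma> (prod_exp \<alpha>) = \<alpha> then t (prod_exp \<alpha>) else 0)" for \<alpha>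
  let ?E = "lead_exp r a P"

  \<comment> \<open>The system is triangular, so the first nonzero coefficient is that of \<open>P\<close> itself.\<close>
  have top: "mfps_nth P \<gamma> = t \<gamma>" if "\<And>\<delta>. \<gamma> \<sqsubset> \<delta> \<Longrightarrow> t \<delta> = 0" for \<gamma>
  proof -
    have "mfps_nth P \<gamma> = (\<Sum>\<delta> | \<gamma> \<sqsubseteq> \<delta>. if \<delta> = \<gamma> then t \<gamma> else 0)"
      unfolding t[of \<gamma>] by (rule sum.cong) (use that b in \<open>auto simp: monic_at_def\<close>)
    then show ?thesis by (simp add: sum.delta finite_above)
  qed
  have t0: "t \<gamma> = 0" if "\<not> \<gamma> \<sqsubseteq> ?E" for \<gamma>
    using wf_above that
  proof (induction \<gamma> rule: wf_induct_rule)
    case (less \<gamma>)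
    have "t \<delta> = 0" if "\<gamma> \<sqsubset> \<delta>" for \<delta>
      using less that by (metis (mono_tags, lifting) case_prodI mem_Collect_eq ord.order.trans)
    then have "t \<gamma> = mfps_nth P \<gamma>" using top by metis
    then show ?case using le_lead_exp[of P \<gamma>] less.prems by auto
  qed
  \<comment> \<open>Hence the expansion begins exactly at the leading exponent of \<open>P\<close>.\<close>
  have tE: "t ?E \<noteq> 0"
  proof -
    have "t \<delta> = 0" if "?E \<sqsubset> \<delta>" for \<delta> using that by (intro t0) (auto dest: ord.order.antisym)
    then show ?thesis using top mfps_nth_lead_exp[OF False] by metis
  qed

  have H: "mfps_nth H \<beta> = (\<Sum>\<gamma>\<in>{\<gamma>. \<beta> \<sqsubseteq> \<gamma>} \<inter> lead_monoid. t \<gamma> * mfps_nth (mfps_power_prod f (\<sigma> \<gamma>)) \<beta>)" for \<beta>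
  proof -
    \<comment> \<open>A bare monomial meets the coefficient at \<open>\<beta>\<close> only when it is the one at \<open>\<beta>\<close>.\<close>
    have "mfps_nth P \<beta> = (\<Sum>\<gamma> | \<beta> \<sqsubseteq> \<gamma>. (if \<gamma> \<in> lead_monoid then t \<gamma> * mfps_nth (mfps_power_prod f (\<sigma> \<gamma>)) \<beta> else 0)
        + (if \<gamma> = \<beta> then mfps_nth R \<beta> else 0))"
      unfolding t[of \<beta>] by (rule sum.cong) (auto simp: b_def R mfps_nth_monom)
    also have "\<dots> = (\<Sum>\<gamma>\<in>{\<gamma>. \<beta> \<sqsubseteq> \<gamma>} \<inter> lead_monoid. t \<gamma> * mfps_nth (mfps_power_prod f (\<sigma> \<gamma>)) \<beta>) + mfps_nth R \<beta>"
      by (simp add: sum.distrib finite_above sum.delta flip: sum.inter_restrict)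
    finally show ?thesis by (simp add: H_def)
  qed
  have has_sum: "((\<lambda>\<alpha>. mfps_const (c \<alpha>) * mfps_power_prod f \<alpha>) has_sum H) UNIV"
    unfolding has_sum_mfps_iff
  proof (intro allI exI conjI impI)
    fix \<beta>
    let ?G = "{\<gamma>. \<beta> \<sqsubseteq> \<gamma>} \<inter> lead_monoid"
    show "finite (\<sigma> ` ?G)" by (simp add: finite_above)
    fix Y assume "finite Y \<and> \<sigma> ` ?G \<subseteq> Y \<and> Y \<subseteq> UNIV"
    then have "(\<Sum>\<alpha>\<in>Y. mfps_nth (mfps_const (c \<alpha>) * mfps_power_prod f \<alpha>) \<beta>) =
        (\<Sum>\<alpha>\<in>\<sigma> ` ?G. mfps_nth (mfps_const (c \<alpha>) * mfps_power_prod f \<alpha>) \<beta>)"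
    proof (intro sum.mono_neutral_right ballI; (elim conjE)?)
      fix \<alpha> assume \<alpha>: "\<alpha> \<in> Y - \<sigma> ` ?G"
      show "mfps_nth (mfps_const (c \<alpha>) * mfps_power_prod f \<alpha>) \<beta> = 0"
      proof (rule ccontr)
        assume "mfps_nth (mfps_const (c \<alpha>) * mfps_power_prod f \<alpha>) \<beta> \<noteq> 0"
        then have "\<sigma> (prod_exp \<alpha>) = \<alpha>" "\<beta> \<sqsubseteq> prod_exp \<alpha>"
          using le_prod_exp[of \<alpha> \<beta>] by (auto simp: c_def split: if_splits)
        then have "\<alpha> \<in> \<sigma> ` ?G" unfolding range_prod_exp[symmetric] by (metis IntI image_eqI mem_Collect_eq rangeI)
        then show False using \<alpha> by blast
      qed
    qed auto
    also have "\<dots> = (\<Sum>\<gamma>\<in>?G. mfps_nth (mfps_const (c (\<sigma> \<gamma>)) * mfps_power_prod f (\<sigma> \<gamma>)) \<beta>)"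
      by (rule sum.reindex_cong[where l = \<sigma>]) (auto intro!: inj_onI, metis \<sigma>)
    also have "\<dots> = mfps_nth H \<beta>"
      unfolding H by (rule sum.cong) (auto simp: c_def \<sigma>)
    finally show "(\<Sum>\<alpha>\<in>Y. mfps_nth (mfps_const (c \<alpha>) * mfps_power_prod f \<alpha>) \<beta>) = mfps_nth H \<beta>" .
  qed auto

  have mem: "H \<in> complete_algebra (range f)"
    using has_sum by (rule has_sum_power_prods_mem_complete_algebra)
  have supp_R: "\<beta> \<notin> lead_monoid \<and> \<beta> \<sqsubseteq> ?E" if "mfps_nth R \<beta> \<noteq> 0" for \<beta>
    using that t0[of \<beta>] by (auto simp: R split: if_splits)
  have supp_H: "\<beta> \<sqsubseteq> ?E" if "mfps_nth H \<beta> \<noteq> 0" for \<beta>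
    using that supp_R[of \<beta>] le_lead_exp[of P \<beta>]
    by (cases "mfps_nth R \<beta> = 0") (auto simp: H_def)
  have lead: "?E = max_wrt (weight_order r a) {lead_exp r a H, lead_exp r a R}" if "H \<noteq> 0" "R \<noteq> 0"
  proof -
    \<comment> \<open>Neither support reaches above \<open>?E\<close>, and the coefficient of \<open>P\<close> there is not zero,
      so at least one of the two summands leads at \<open>?E\<close>.\<close>
    have "lead_exp r a H \<sqsubseteq> ?E" "lead_exp r a R \<sqsubseteq> ?E"
      using that supp_H supp_R mfps_nth_lead_exp by blast+
    moreover have "mfps_nth H ?E \<noteq> 0 \<or> mfps_nth R ?E \<noteq> 0"
      using mfps_nth_lead_exp[OF False] by (auto simp: H_def)
    then have "lead_exp r a H = ?E \<or> lead_exp r a R = ?E"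
      using lead_exp_eqI[of H ?E] lead_exp_eqI[of R ?E] supp_H supp_R by blast
    moreover have "antisym (weight_order r a)" by (rule antisymI) (rule ord.order.antisym)
    ultimately show ?thesis by (intro max_wrt_eqI[symmetric]) auto
  qed
  have bound: "prod_exp \<alpha> \<sqsubseteq> ?E" if "c \<alpha> \<noteq> 0" for \<alpha>
    using that t0 by (auto simp: c_def split: if_splits)
  have unique: "\<exists>!\<alpha>. c \<alpha> \<noteq> 0 \<and> ?E = prod_exp \<alpha>" if "R = 0"
  proof -
    have "?E \<in> lead_monoid" using that R[of ?E] tE by (auto split: if_splits)
    then have "prod_exp (\<sigma> ?E) = ?E" by (rule \<sigma>)
    then show ?thesis using tE by (intro ex1I[of _ "\<sigma> ?E"]) (auto simp: c_def split: if_splits)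
  qed
  have "P = H + R" by (simp add: H_def)
  moreover have "\<exists>c. ((\<lambda>\<alpha>. mfps_const (c \<alpha>) * mfps_power_prod f \<alpha>) has_sum H) UNIV \<and>
      (\<forall>\<alpha>. c \<alpha> \<noteq> 0 \<longrightarrow> prod_exp \<alpha> \<sqsubseteq> ?E) \<and> (R = 0 \<longrightarrow> (\<exists>!\<alpha>. c \<alpha> \<noteq> 0 \<and> ?E = prod_exp \<alpha>))"
    using has_sum bound unique by (intro exI[of _ c] conjI allI impI)
  moreover have "R \<noteq> 0 \<longrightarrow> (\<forall>\<beta>\<in>mfps_supp R. \<beta> \<notin> lead_monoid \<and> \<beta> \<sqsubseteq> ?E)"
    using supp_R by (simp add: mfps_supp_def)
  ultimately have "is_remainder r a f P R"
    unfolding is_remainder_def if_not_P[OF False]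
    using lead by (intro bexI[OF _ mem] conjI) (assumption | blast)+
  then show ?thesis ..
qed (auto simp: is_remainder_def)

text \<open>With \<open>P\<close> the remainder lies in the algebra, so for a canonical basis its leading exponent is in the
  semigroup, whereas a remainder has no exponent there.\<close>

lemma remainder_eq_zero:
  assumes canonical: "canonical_basis r a (complete_algebra (range f)) (range f)"
    and P: "P \<in> complete_algebra (range f)" and rem: "is_remainder r a f P R"
  shows "R = 0"
proof (rule ccontr)
  assume "R \<noteq> 0"
  then have "P \<noteq> 0" using rem by (auto simp: is_remainder_def)
  then obtain H where "H \<in> complete_algebra (range f)" "P = H + R"
    and R: "\<forall>\<beta>\<in>mfps_supp R. \<beta> \<notin> lead_monoid"
    using rem \<open>R \<noteq> 0\<close> unfolding is_remainder_def by auto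
  then have "R \<in> complete_algebra (range f)"
    using complete_algebra_diff[OF P] by (metis add_diff_cancel_left')
  then have "lead_exp r a R \<in> lead_monoid"
    using canonical \<open>R \<noteq> 0\<close> by (auto simp: canonical_basis_iff lead_exps_def)
  moreover have "lead_exp r a R \<in> mfps_supp R"
    using \<open>R \<noteq> 0\<close> by (simp add: mfps_supp_def mfps_nth_lead_exp)
  ultimately show False using R by blast
qed

end

section \<open>Relations between leading monomials\<close>

context monic_family
begin

abbreviation relations :: "((nat ^ 's) \<Rightarrow>\<^sub>0 'k) set" where
  "relations \<equiv> lead_monomial_kernel r a f"

abbreviation lead_subst :: "((nat ^ 's) \<Rightarrow>\<^sub>0 'k) \<Rightarrow> ('k, 'n) mfps" where
  "lead_subst \<equiv> mfps_subst (\<lambda>i. lead_monomial r a (f i))"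

lemma nth_lead_subst:
  assumes "finite T" "Poly_Mapping.keys p \<subseteq> T"
  shows "mfps_nth (lead_subst p) \<gamma> = (\<Sum>\<alpha>\<in>T. if prod_exp \<alpha> = \<gamma> then Poly_Mapping.lookup p \<alpha> else 0)"
  unfolding mfps_subst_superset[OF assms] mfps_nth_sum
  by (rule sum.cong) (auto simp: power_prod_lead_monomial mfps_nth_monom)

lemma relations_diff: "p \<in> relations \<Longrightarrow> p' \<in> relations \<Longrightarrow> p - p' \<in> relations"
  by (simp add: lead_monomial_kernel_def mfps_subst_diff)

lemma relations_mult_single: "p \<in> relations \<Longrightarrow> Poly_Mapping.single \<delta> c * p \<in> relations"
  by (simp add: lead_monomial_kernel_def mfps_subst_mult_single)

text \<open>Giving the monomial with exponent \<open>\<alpha>\<close> the degree \<open>prod_exp \<alpha>\<close> grades the polynomial ring by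
  the exponents of the power series ring.  The morphism to leading monomials is homogeneous, so its
  kernel is spanned by homogeneous elements.\<close>

definition graded_part :: "nat ^ 'n \<Rightarrow> ((nat ^ 's) \<Rightarrow>\<^sub>0 'k) \<Rightarrow> ((nat ^ 's) \<Rightarrow>\<^sub>0 'k)" where
  "graded_part \<gamma> p =
    (\<Sum>\<alpha> | \<alpha> \<in> Poly_Mapping.keys p \<and> prod_exp \<alpha> = \<gamma>. Poly_Mapping.single \<alpha> (Poly_Mapping.lookup p \<alpha>))"

lemma lookup_graded_part:
  "Poly_Mapping.lookup (graded_part \<gamma> p) \<alpha> = (if prod_exp \<alpha> = \<gamma> then Poly_Mapping.lookup p \<alpha> else 0)"
  unfolding graded_part_def lookup_sum
  by (auto simp: lookup_single when_def sum.delta in_keys_iff)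

lemma keys_graded_part:
  "Poly_Mapping.keys (graded_part \<gamma> p) = {\<alpha> \<in> Poly_Mapping.keys p. prod_exp \<alpha> = \<gamma>}"
  by (auto simp: in_keys_iff lookup_graded_part split: if_splits)

lemma nth_lead_subst_graded_part:
  "mfps_nth (lead_subst (graded_part \<gamma> p)) \<delta> = (if \<delta> = \<gamma> then mfps_nth (lead_subst p) \<gamma> else 0)"
proof -
  have "mfps_nth (lead_subst (graded_part \<gamma> p)) \<delta> =
      (\<Sum>\<alpha>\<in>Poly_Mapping.keys p. if prod_exp \<alpha> = \<delta> then Poly_Mapping.lookup (graded_part \<gamma> p) \<alpha> else 0)"
    by (rule nth_lead_subst) (auto simp: keys_graded_part)
  also have "\<dots> = (\<Sum>\<alpha>\<in>Poly_Mapping.keys p. if \<delta> = \<gamma> then if prod_exp \<alpha> = \<gamma> then Poly_Mapping.lookup p \<alpha> else 0 else 0)"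
    by (rule sum.cong) (auto simp: lookup_graded_part)
  also have "\<dots> = (if \<delta> = \<gamma> then mfps_nth (lead_subst p) \<gamma> else 0)"
    by (simp add: nth_lead_subst[OF finite_keys order_refl])
  finally show ?thesis .
qed

lemma graded_part_mem_relations:
  assumes "mfps_nth (lead_subst p) \<gamma> = 0"
  shows "graded_part \<gamma> p \<in> relations"
  using assms unfolding lead_monomial_kernel_def
  by (auto intro!: mfps_eqI simp: nth_lead_subst_graded_part)

text \<open>At an upper bound of the degrees only the leading terms of the products contribute, which
  links substitution of the family to substitution of its leading monomials.  A homogeneous
  polynomial is thus a relation iff its leading terms cancel on substitution.\<close>

lemma top_coefficient:
  assumes "\<And>\<alpha>. \<alpha> \<in> Poly_Mapping.keys p \<Longrightarrow> prod_exp \<alpha> \<sqsubseteq> \<gamma>"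
  shows "mfps_nth (mfps_subst f p) \<gamma> = mfps_nth (lead_subst p) \<gamma>"
proof -
  have "mfps_nth (mfps_power_prod f \<alpha>) \<gamma> = (if prod_exp \<alpha> = \<gamma> then 1 else 0)"
    if "\<alpha> \<in> Poly_Mapping.keys p" for \<alpha>
    using assms[OF that] le_prod_exp[of \<alpha> \<gamma>] nth_power_prod_prod_exp[of \<alpha>]
    by (auto dest: ord.order.antisym)
  then show ?thesis
    unfolding mfps_nth_subst[of f] nth_lead_subst[OF finite_keys order_refl] by (intro sum.cong) auto
qed

lemma nth_subst_nonzeroE:
  assumes "mfps_nth (mfps_subst f p) \<beta> \<noteq> 0"
  obtains \<alpha> where "\<alpha> \<in> Poly_Mapping.keys p" "\<beta> \<sqsubseteq> prod_exp \<alpha>"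
proof -
  obtain \<alpha> where "\<alpha> \<in> Poly_Mapping.keys p"
    "Poly_Mapping.lookup p \<alpha> * mfps_nth (mfps_power_prod f \<alpha>) \<beta> \<noteq> 0"
    using assms unfolding mfps_nth_subst by (rule sum.not_neutral_contains_not_neutral)
  then show thesis using that[of \<alpha>] le_prod_exp[of \<alpha> \<beta>] by auto
qed

text \<open>The kernel is a graded ideal.  Removing from \<open>g\<close> the component of its leading monomial leaves a
  relation \<open>h\<close>; a nonzero \<open>h\<close> would have a leading monomial divisible by that of some basis element,
  although it is a monomial of the tail of \<open>g\<close>.  Being reduced forbids this for the other
  elements, and the monomial order forbids it for \<open>g\<close>.\<close>

lemma reduced_groebner_basis_homogeneous:
  assumes q: "compatible_well_order q"
    and G: "reduced_groebner_basis q relations G" and g: "g \<in> G" and \<alpha>: "\<alpha> \<in> Poly_Mapping.keys g"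
  shows "prod_exp \<alpha> = prod_exp (poly_lead_exp q g)"
proof (rule ccontr)
  assume neq: "prod_exp \<alpha> \<noteq> prod_exp (poly_lead_exp q g)"
  let ?\<epsilon> = "poly_lead_exp q g"
  define h where "h = g - graded_part (prod_exp ?\<epsilon>) g"
  note G' = G[unfolded reduced_groebner_basis_def groebner_basis_def]
  have gb: "g \<in> relations" "g \<noteq> 0" using G' g by (metis subsetD, metis)
  have div: "\<exists>g'\<in>G. poly_lead_exp q g' \<le> poly_lead_exp q p" if "p \<in> relations" "p \<noteq> 0" for p
    using G' that by simp
  have red: "\<not> poly_lead_exp q g' \<le> \<beta>" if "g' \<in> G - {g}" "\<beta> \<in> Poly_Mapping.keys g" for g' \<beta>
    using G'[THEN conjunct2, THEN conjunct2] g that by blast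
  have keys_h: "Poly_Mapping.keys h = {\<beta> \<in> Poly_Mapping.keys g. prod_exp \<beta> \<noteq> prod_exp ?\<epsilon>}"
    by (auto simp: h_def in_keys_iff lookup_minus lookup_graded_part split: if_splits)
  have "h \<in> relations" unfolding h_def
    by (intro relations_diff graded_part_mem_relations gb)
      (use gb(1) in \<open>simp add: lead_monomial_kernel_def\<close>)
  have "\<alpha> \<in> Poly_Mapping.keys h" by (simp add: keys_h \<alpha> neq)
  then have "h \<noteq> 0" by auto
  with \<open>h \<in> relations\<close> obtain g' where g': "g' \<in> G" "poly_lead_exp q g' \<le> poly_lead_exp q h"
    using div by blast
  have \<beta>: "poly_lead_exp q h \<in> Poly_Mapping.keys g" "prod_exp (poly_lead_exp q h) \<noteq> prod_exp ?\<epsilon>"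
    using poly_lead_exp_props(1)[OF q \<open>h \<noteq> 0\<close>] keys_h by auto
  have "g' = g" using red[of g' "poly_lead_exp q h"] g' \<beta> by blast
  then have "(?\<epsilon>, poly_lead_exp q h) \<in> q" using compatible_well_order_of_le[OF q] g'(2) by blast
  moreover have "(poly_lead_exp q h, ?\<epsilon>) \<in> q" using poly_lead_exp_props(2)[OF q gb(2)] \<beta>(1) by blast
  ultimately show False using compatible_well_orderD(2)[OF q] \<beta>(2) by (metis antisymD)
qed

section \<open>Rewriting below a given exponent\<close>

text \<open>Up to weight \<open>N\<close> the series equals a polynomial in the family all of whose terms have a
  leading exponent below \<open>\<gamma>\<close>.  Only finitely many exponents have weight at most \<open>N\<close>, so truncating
  replaces infinite expressions in the family by polynomials and makes descent arguments finite.\<close>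

definition rewritable :: "rat \<Rightarrow> nat ^ 'n \<Rightarrow> ('k, 'n) mfps \<Rightarrow> bool" where
  "rewritable N \<gamma> h \<longleftrightarrow> (\<exists>p. (\<forall>\<alpha>\<in>Poly_Mapping.keys p. prod_exp \<alpha> \<sqsubset> \<gamma>) \<and>
     (\<forall>\<beta>. weight a \<beta> \<le> N \<longrightarrow> mfps_nth (mfps_subst f p) \<beta> = mfps_nth h \<beta>))"

lemma rewritable_zero: "rewritable N \<gamma> 0"
  unfolding rewritable_def by (rule exI[of _ 0]) simp

lemma rewritable_add:
  assumes "rewritable N \<gamma> g" "rewritable N \<gamma> h"
  shows "rewritable N \<gamma> (g + h)"
proof -
  obtain p p' where "\<forall>\<alpha>\<in>Poly_Mapping.keys p. prod_exp \<alpha> \<sqsubset> \<gamma>" "\<forall>\<alpha>\<in>Poly_Mapping.keys p'. prod_exp \<alpha> \<sqsubset> \<gamma>"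
    and eq: "\<forall>\<beta>. weight a \<beta> \<le> N \<longrightarrow> mfps_nth (mfps_subst f p) \<beta> = mfps_nth g \<beta>"
      "\<forall>\<beta>. weight a \<beta> \<le> N \<longrightarrow> mfps_nth (mfps_subst f p') \<beta> = mfps_nth h \<beta>"
    using assms unfolding rewritable_def by blast
  then have "\<forall>\<alpha>\<in>Poly_Mapping.keys (p + p'). prod_exp \<alpha> \<sqsubset> \<gamma>"
    using Poly_Mapping.keys_add[of p p'] by blast
  then show ?thesis unfolding rewritable_def
    using eq by (intro exI[of _ "p + p'"]) (simp add: mfps_subst_add)
qed

lemma keys_mult_single:
  "Poly_Mapping.keys (Poly_Mapping.single \<delta> c * p) \<subseteq> (\<lambda>\<alpha>. \<delta> + \<alpha>) ` Poly_Mapping.keys (p :: (nat ^ 's) \<Rightarrow>\<^sub>0 'k)"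
  using keys_mult[of "Poly_Mapping.single \<delta> c" p] by (auto split: if_splits)

lemma rewritable_mult:
  assumes "rewritable N \<gamma> h"
  shows "rewritable N (prod_exp \<delta> + \<gamma>) (mfps_const c * mfps_power_prod f \<delta> * h)"
proof -
  obtain p where p: "\<forall>\<alpha>\<in>Poly_Mapping.keys p. prod_exp \<alpha> \<sqsubset> \<gamma>"
    and eq: "\<forall>\<beta>. weight a \<beta> \<le> N \<longrightarrow> mfps_nth (mfps_subst f p) \<beta> = mfps_nth h \<beta>"
    using assms unfolding rewritable_def by blast
  show ?thesis unfolding rewritable_def
  proof (intro exI conjI ballI allI impI)
    fix \<alpha> assume "\<alpha> \<in> Poly_Mapping.keys (Poly_Mapping.single \<delta> c * p)"
    then obtain \<alpha>' where "\<alpha> = \<delta> + \<alpha>'" "\<alpha>' \<in> Poly_Mapping.keys p" using keys_mult_single[of \<delta> c p] by blast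
    then show "prod_exp \<alpha> \<sqsubseteq> prod_exp \<delta> + \<gamma>" "prod_exp \<alpha> \<noteq> prod_exp \<delta> + \<gamma>"
      using p less_add_right[of "prod_exp \<alpha>'" \<gamma> "prod_exp \<delta>"] by (auto simp: prod_exp_add add.commute)
  next
    fix \<beta> assume "weight a \<beta> \<le> N"
    then have "mfps_nth (u * mfps_subst f p) \<beta> = mfps_nth (u * h) \<beta>" for u
      unfolding mfps_nth_mult
    proof (intro sum.cong refl, safe)
      fix x y assume "weight a (x + y) \<le> N"
      then have "weight a y \<le> N" using weight_nonneg[of x] by (simp add: weight_add)
      then show "mfps_nth u x * mfps_nth (mfps_subst f p) y = mfps_nth u x * mfps_nth h y"
        using eq by simp
    qed
    then show "mfps_nth (mfps_subst f (Poly_Mapping.single \<delta> c * p)) \<beta> =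
        mfps_nth (mfps_const c * mfps_power_prod f \<delta> * h) \<beta>"
      by (simp only: mfps_subst_mult_single)
  qed
qed

text \<open>Substituting into a homogeneous relation cancels the terms at its degree, so the result leads
  strictly below; an expression witnessing the remainder \<open>0\<close> stays at or below that leading exponent.\<close>

lemma rewritable_of_zero_remainder:
  assumes rel: "g \<in> relations" and hom: "\<And>\<alpha>. \<alpha> \<in> Poly_Mapping.keys g \<Longrightarrow> prod_exp \<alpha> = \<gamma>"
    and rem: "is_remainder r a f (mfps_subst f g) 0"
  shows "rewritable N \<gamma> (mfps_subst f g)"
proof (cases "mfps_subst f g = 0")
  case True
  then show ?thesis by (simp add: rewritable_zero)
next
  case False
  let ?P = "mfps_subst f g"
  have "lead_exp r a ?P \<sqsubseteq> \<gamma>"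
    using nth_subst_nonzeroE[OF mfps_nth_lead_exp[OF False]] hom by metis
  moreover have "mfps_nth ?P \<gamma> = 0"
    using rel top_coefficient[of g \<gamma>] hom by (simp add: lead_monomial_kernel_def)
  then have "lead_exp r a ?P \<noteq> \<gamma>" using mfps_nth_lead_exp[OF False] by metis
  ultimately have lead: "lead_exp r a ?P \<sqsubset> \<gamma>" by blast
  obtain c where sum: "((\<lambda>\<alpha>. mfps_const (c \<alpha>) * mfps_power_prod f \<alpha>) has_sum ?P) UNIV"
    and c: "\<And>\<alpha>. c \<alpha> \<noteq> 0 \<Longrightarrow> prod_exp \<alpha> \<sqsubseteq> lead_exp r a ?P"
    using rem False unfolding is_remainder_def by auto
  obtain p where p: "\<And>\<alpha>. \<alpha> \<in> Poly_Mapping.keys p \<Longrightarrow> c \<alpha> \<noteq> 0"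
    "\<And>\<beta>. \<beta> \<in> {\<beta>. weight a \<beta> \<le> N} \<Longrightarrow> mfps_nth (mfps_subst f p) \<beta> = mfps_nth ?P \<beta>"
    using has_sum_power_prods_truncate[OF sum finite_weight_le] by blast
  have "prod_exp \<alpha> \<sqsubset> \<gamma>" if "\<alpha> \<in> Poly_Mapping.keys p" for \<alpha>
    using c[OF p(1)[OF that]] lead by (rule ord.le_less_trans)
  then show ?thesis unfolding rewritable_def using p(2) by (intro exI[of _ p]) simp
qed

text \<open>Division by the Groebner basis: subtract from \<open>p\<close> the monomial multiple of a basis element
  with the same leading term.  Homogeneity of that element keeps everything in degree \<open>\<gamma>\<close>, and
  the monomial order makes the process stop.\<close>

lemma rewritable_homogeneous_relation:
  assumes q: "compatible_well_order q" and G: "reduced_groebner_basis q relations G"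
    and rem: "\<And>g. g \<in> G \<Longrightarrow> is_remainder r a f (mfps_subst f g) 0"
    and "p \<in> relations" and "\<And>\<alpha>. \<alpha> \<in> Poly_Mapping.keys p \<Longrightarrow> prod_exp \<alpha> = \<gamma>"
  shows "rewritable N \<gamma> (mfps_subst f p)"
  using wf_inv_image[OF compatible_well_orderD(6)[OF q], of "poly_lead_exp q"] assms(4,5)
proof (induction p rule: wf_induct_rule)
  case (less p)
  show ?case
  proof (cases "p = 0")
    case True
    then show ?thesis by (simp add: rewritable_zero)
  next
    case False
    let ?\<epsilon> = "poly_lead_exp q p"
    have gb: "G \<subseteq> relations" "0 \<notin> G" "\<exists>g\<in>G. poly_lead_exp q g \<le> ?\<epsilon>"
      and monic_G: "\<And>g. g \<in> G \<Longrightarrow> Poly_Mapping.lookup g (poly_lead_exp q g) = 1"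
      using G False less.prems(1) unfolding reduced_groebner_basis_def groebner_basis_def by blast+
    then obtain g where g: "g \<in> G" "poly_lead_exp q g \<le> ?\<epsilon>" by blast
    then obtain \<delta> where \<delta>: "?\<epsilon> = \<delta> + poly_lead_exp q g" using vec_le_imp_add by blast
    have "g \<noteq> 0" using gb(2) g(1) by blast
    note hom_g = reduced_groebner_basis_homogeneous[OF q G g(1)]
    define c where "c = Poly_Mapping.lookup p ?\<epsilon>"
    define u where "u = Poly_Mapping.single \<delta> c * g"
    have \<epsilon>_\<gamma>: "prod_exp ?\<epsilon> = \<gamma>" using less.prems(2) poly_lead_exp_props(1)[OF q False] by blast
    have u_lead: "Poly_Mapping.lookup u ?\<epsilon> = c"
      unfolding u_def \<delta> using monic_G[OF g(1)] by (simp add: lookup_single_mult_add)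
    have keys_u: "prod_exp \<alpha> = \<gamma> \<and> (\<alpha>, ?\<epsilon>) \<in> q" if \<alpha>: "\<alpha> \<in> Poly_Mapping.keys u" for \<alpha>
    proof -
      obtain \<beta> where \<beta>: "\<alpha> = \<delta> + \<beta>" "\<beta> \<in> Poly_Mapping.keys g"
        using \<alpha> keys_mult_single[of \<delta> c g] unfolding u_def by blast
      have "(\<beta> + \<delta>, poly_lead_exp q g + \<delta>) \<in> q"
        by (intro compatible_well_orderD(7)[OF q] poly_lead_exp_props(2)[OF q \<open>g \<noteq> 0\<close>] \<beta>(2))
      moreover have "prod_exp \<alpha> = \<gamma>"
        using \<beta> hom_g[OF \<beta>(2)] \<epsilon>_\<gamma> by (simp add: \<delta> prod_exp_add)
      ultimately show ?thesis by (simp add: \<beta> \<delta> add.commute)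
    qed
    have "rewritable N \<gamma> (mfps_subst f (p - u))"
    proof (cases "p - u = 0")
      case True
      then show ?thesis by (simp add: rewritable_zero)
    next
      case nz: False
      have keys: "prod_exp \<alpha> = \<gamma> \<and> (\<alpha>, ?\<epsilon>) \<in> q" if "\<alpha> \<in> Poly_Mapping.keys (p - u)" for \<alpha>
        using that keys_u[of \<alpha>] less.prems(2)[of \<alpha>] poly_lead_exp_props(2)[OF q False, of \<alpha>]
        by (cases "Poly_Mapping.lookup p \<alpha> = 0") (auto simp: in_keys_iff lookup_minus)
      have "?\<epsilon> \<notin> Poly_Mapping.keys (p - u)" by (simp add: in_keys_iff lookup_minus u_lead c_def)
      then have "(poly_lead_exp q (p - u), ?\<epsilon>) \<in> q - Id"
        using keys[OF poly_lead_exp_props(1)[OF q nz]] poly_lead_exp_props(1)[OF q nz] by auto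
      moreover have "p - u \<in> relations"
        unfolding u_def using less.prems(1) gb(1) g(1) by (intro relations_diff relations_mult_single) auto
      ultimately show ?thesis using keys by (intro less.IH) auto
    qed
    moreover have "rewritable N \<gamma> (mfps_subst f u)"
    proof -
      have "rewritable N (prod_exp (poly_lead_exp q g)) (mfps_subst f g)"
        using gb(1) g(1) hom_g rem[OF g(1)] by (intro rewritable_of_zero_remainder) auto
      from rewritable_mult[OF this, of \<delta> c] show ?thesis
        using \<epsilon>_\<gamma> by (simp add: u_def mfps_subst_mult_single \<delta> prod_exp_add)
    qed
    ultimately have "rewritable N \<gamma> (mfps_subst f (p - u) + mfps_subst f u)" by (rule rewritable_add)
    then show ?thesis by (simp flip: mfps_subst_add)
  qed
qed

text \<open>Let \<open>\<gamma>\<close> be the highest leading exponent among the terms of a polynomial expression that agrees with \<open>h\<close>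
  up to the weight of its leading exponent.  If \<open>\<gamma>\<close>
  is above the leading exponent of \<open>h\<close>, the leading terms at \<open>\<gamma>\<close> cancel, so the terms there form a relation and can be
  rewritten below \<open>\<gamma>\<close>.  Only finitely many exponents lie above that of \<open>h\<close>, so after finitely
  many such steps \<open>\<gamma>\<close> is the leading exponent of \<open>h\<close>.\<close>

lemma lead_exp_mem_lead_monoid:
  assumes "h \<noteq> 0"
    and rewrite: "\<And>\<gamma> p. p \<in> relations \<Longrightarrow> (\<And>\<alpha>. \<alpha> \<in> Poly_Mapping.keys p \<Longrightarrow> prod_exp \<alpha> = \<gamma>) \<Longrightarrow>
      rewritable (weight a (lead_exp r a h)) \<gamma> (mfps_subst f p)"
    and "\<And>\<beta>. weight a \<beta> \<le> weight a (lead_exp r a h) \<Longrightarrow> mfps_nth (mfps_subst f p) \<beta> = mfps_nth h \<beta>"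
  shows "lead_exp r a h \<in> lead_monoid"
  using assms(3)
proof (induction p rule: measure_induct_rule[where f =
      "\<lambda>p. card {\<beta>. lead_exp r a h \<sqsubseteq> \<beta> \<and> (\<exists>\<alpha>\<in>Poly_Mapping.keys p. \<beta> \<sqsubseteq> prod_exp \<alpha>)}"])
  case (less p)
  let ?E = "lead_exp r a h" and ?N = "weight a (lead_exp r a h)"
  define above where "above p = {\<beta>. ?E \<sqsubseteq> \<beta> \<and> (\<exists>\<alpha>\<in>Poly_Mapping.keys p. \<beta> \<sqsubseteq> prod_exp \<alpha>)}"
    for p :: "(nat ^ 's) \<Rightarrow>\<^sub>0 'k"
  have fin: "finite (above p)" for p
    by (rule finite_subset[OF _ finite_above[of ?E]]) (auto simp: above_def)
  define \<gamma> where "\<gamma> = ord.Max (prod_exp ` Poly_Mapping.keys p)"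
  have "mfps_nth (mfps_subst f p) ?E \<noteq> 0" using less.prems[of ?E] mfps_nth_lead_exp[OF assms(1)] by simp
  then obtain \<alpha> where \<alpha>: "\<alpha> \<in> Poly_Mapping.keys p" "?E \<sqsubseteq> prod_exp \<alpha>" by (rule nth_subst_nonzeroE)
  have top: "prod_exp \<alpha> \<sqsubseteq> \<gamma>" if "\<alpha> \<in> Poly_Mapping.keys p" for \<alpha>
    unfolding \<gamma>_def using that by (intro ord.Max_ge) auto
  have "\<gamma> \<in> prod_exp ` Poly_Mapping.keys p" unfolding \<gamma>_def using \<alpha> by (intro ord.Max_in) auto
  then obtain \<alpha>0 where \<alpha>0: "\<alpha>0 \<in> Poly_Mapping.keys p" "\<gamma> = prod_exp \<alpha>0" by blast
  have E\<gamma>: "?E \<sqsubseteq> \<gamma>" using \<alpha> top by (metis ord.order.trans)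
  show ?case
  proof (cases "?E = \<gamma>")
    case True
    then show ?thesis using \<alpha>0 range_prod_exp by blast
  next
    case False
    have "mfps_nth h \<gamma> = 0" using le_lead_exp[of h \<gamma>] E\<gamma> False by (metis ord.order.antisym)
    then have "mfps_nth (lead_subst p) \<gamma> = 0"
      using top_coefficient[OF top] less.prems[OF weight_antimono[OF E\<gamma>]] by simp
    then have "rewritable ?N \<gamma> (mfps_subst f (graded_part \<gamma> p))"
      by (intro rewrite graded_part_mem_relations) (auto simp: keys_graded_part)
    moreover have "rewritable ?N \<gamma> (mfps_subst f (p - graded_part \<gamma> p))"
      unfolding rewritable_def
    proof (intro exI conjI ballI)
      fix \<alpha> assume "\<alpha> \<in> Poly_Mapping.keys (p - graded_part \<gamma> p)"
      then show "prod_exp \<alpha> \<sqsubseteq> \<gamma>" "prod_exp \<alpha> \<noteq> \<gamma>"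
        using top by (auto simp: in_keys_iff lookup_minus lookup_graded_part split: if_splits)
    qed simp
    ultimately have "rewritable ?N \<gamma> (mfps_subst f (graded_part \<gamma> p) + mfps_subst f (p - graded_part \<gamma> p))"
      by (rule rewritable_add)
    then have "rewritable ?N \<gamma> (mfps_subst f p)" by (simp flip: mfps_subst_add)
    then obtain p' where p': "\<And>\<alpha>. \<alpha> \<in> Poly_Mapping.keys p' \<Longrightarrow> prod_exp \<alpha> \<sqsubset> \<gamma>"
        "\<And>\<beta>. weight a \<beta> \<le> ?N \<Longrightarrow> mfps_nth (mfps_subst f p') \<beta> = mfps_nth h \<beta>"
      unfolding rewritable_def using less.prems by auto
    have "above p' \<subseteq> above p"
      unfolding above_def using p'(1) \<alpha>0 by (auto intro: ord.order.trans)
    moreover have "\<gamma> \<in> above p" using E\<gamma> \<alpha>0 by (auto simp: above_def)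
    moreover have "\<gamma> \<notin> above p'" using p'(1) by (auto simp: above_def dest: ord.order.antisym)
    ultimately have "above p' \<subset> above p" by blast
    then have "card (above p') < card (above p)" by (rule psubset_card_mono[OF fin])
    then show ?thesis using p'(2) by (intro less.IH[of p']) (auto simp: above_def)
  qed
qed

lemma canonical_basis_of_zero_remainders:
  assumes "compatible_well_order q" "reduced_groebner_basis q relations G"
    and "\<And>g. g \<in> G \<Longrightarrow> is_remainder r a f (mfps_subst f g) 0"
  shows "canonical_basis r a (complete_algebra (range f)) (range f)"
  unfolding canonical_basis_iff
proof
  fix \<gamma> assume "\<gamma> \<in> lead_exps r a (complete_algebra (range f))"
  then obtain h where h: "h \<in> complete_algebra (range f)" "h \<noteq> 0" "\<gamma> = lead_exp r a h"
    by (auto simp: lead_exps_def)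
  then obtain p where "\<forall>\<beta>\<in>{\<beta>. weight a \<beta> \<le> weight a \<gamma>}. mfps_nth (mfps_subst f p) \<beta> = mfps_nth h \<beta>"
    unfolding mem_complete_algebra_iff using finite_weight_le by blast
  then show "\<gamma> \<in> lead_monoid" unfolding h(3)
    by (intro lead_exp_mem_lead_monoid[OF h(2), of p] rewritable_homogeneous_relation[OF assms]) auto
qed

end

theorem proposition13:
  fixes r :: "(nat ^ 'n::finite) rel"
    and q :: "(nat ^ 's::finite) rel"
    and a :: "rat ^ 'n"
    and f :: "'s \<Rightarrow> ('k::field, 'n) mfps"
    and A :: "('k, 'n) mfps set"
    and G :: "((nat ^ 's) \<Rightarrow>\<^sub>0 'k) set"
  assumes "compatible_well_order r"
    and "compatible_well_order q"
    and "\<And>i. a $ i > 0"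
    and "\<And>i. f i \<noteq> 0"
    and "\<And>i. monic_wrt r a (f i)"
    and "A = complete_algebra (range f)"
    and "s_polynomials r a q f G"
  shows "(canonical_basis r a A (range f) \<longleftrightarrow>
            (\<forall>p\<in>G. is_remainder r a f (mfps_subst f p) 0)) \<and>
         (canonical_basis r a A (range f) \<longleftrightarrow>
            (\<forall>p\<in>G. \<forall>R. is_remainder r a f (mfps_subst f p) R \<longrightarrow> R = 0))"
proof -
  interpret weighted_order r a by unfold_locales (use assms in auto)
  interpret monic_family r a f
  proof
    show "monic_at (f i) (lead_exp r a (f i))" for i
      using assms(5)[of i] le_lead_exp[of "f i"] by (simp add: monic_at_def monic_wrt_def)
  qed
  have G: "reduced_groebner_basis q relations G" using assms(7) by (simp add: s_polynomials_def)
  have "R = 0" if "canonical_basis r a A (range f)" "is_remainder r a f (mfps_subst f p) R" for p R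
    using that remainder_eq_zero[OF _ mfps_subst_mem_complete_algebra] assms(6) by blast
  moreover have "\<exists>R. is_remainder r a f (mfps_subst f p) R" for p
    by (rule exists_remainder)
  moreover have "canonical_basis r a A (range f)"
    if "\<forall>p\<in>G. is_remainder r a f (mfps_subst f p) 0"
    using canonical_basis_of_zero_remainders[OF assms(2) G] that assms(6) by blast
  ultimately show ?thesis by metis
qed

end
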